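(* For every $d>0$ there exist constants $\alpha,\alpha'>0$ depending only on $d$ such that for every $q\in(0,1/2)$ and every integer $L\in[1,d/q]$, with $n=\lceil\log_2L\rceil$, $$\frac{n!}{q^n2^{\binom n2}}\,q^{\alpha}\le T_{\rm rel}(L)\le\frac{n!}{q^n2^{\binom n2}}\,q^{-\alpha'}.$$
   Context: Fix $q\in(0,1/2)$, $p=1-q$. For an integer $L\ge1$ let $\Lambda=\{1,\dots,L\}$, $\Omega_\Lambda=\{0,1\}^\Lambda$, and $\pi$ the product measure with $\pi(\sigma_x=1)=p$, $\pi(\sigma_x=0)=q$. The East process on $\Lambda$ has generator $\mathcal L_\Lambda f(\sigma)=\sum_{x\in\Lambda}c_x(\sigma)[\pi_x(f)-f](\sigma)$ with $c_1\equiv1$, $c_x(\sigma)=1-\sigma_{x-1}$ for $x\ge2$, where $\pi_x(f)$ averages $f$ over $\sigma_x\sim$ Bernoulli$(p)$. Its Dirichlet form is $\mathcal D_\Lambda(f)=\sum_x\pi(c_x\mathrm{Var}_x(f))$, and $T_{\rm rel}(L)$ is the inverse of the spectral gap $\inf_{f\text{ non-constant}}\mathcal D_\Lambda(f)/\mathrm{Var}_\pi(f)$. *)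

theory Defs
  imports Complex_Main
begin

text \<open>East process on \<Lambda> = {1..L}. A configuration \<sigma> \<in> {0,1}^\<Lambda> is encoded by the set
  A = {x. \<sigma>_x = 1} \<subseteq> {1..L}; so \<Omega>_\<Lambda> = Pow {1..L}.
  pi(\<sigma>_x = 1) = p = 1 - q, pi(\<sigma>_x = 0) = q.\<close>

definition east_conf :: "nat \<Rightarrow> nat set set" where
  "east_conf L = Pow {1..L}"

definition east_pi :: "real \<Rightarrow> nat \<Rightarrow> nat set \<Rightarrow> real" where
  "east_pi q L A = (1 - q) ^ card A * q ^ (L - card A)"

definition east_mean :: "real \<Rightarrow> nat \<Rightarrow> (nat set \<Rightarrow> real) \<Rightarrow> real" where
  "east_mean q L f = (\<Sum>A\<in>east_conf L. east_pi q L A * f A)"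

definition east_var :: "real \<Rightarrow> nat \<Rightarrow> (nat set \<Rightarrow> real) \<Rightarrow> real" where
  "east_var q L f = east_mean q L (\<lambda>A. (f A - east_mean q L f)^2)"

definition east_c :: "nat \<Rightarrow> nat set \<Rightarrow> real" where
  "east_c x A = (if x = 1 then 1 else if x - 1 \<in> A then 0 else 1)"

definition east_local_var :: "real \<Rightarrow> nat \<Rightarrow> (nat set \<Rightarrow> real) \<Rightarrow> nat set \<Rightarrow> real" where
  "east_local_var q x f A =
     (let m = (1 - q) * f (insert x A) + q * f (A - {x})
      in (1 - q) * (f (insert x A) - m)^2 + q * (f (A - {x}) - m)^2)"

definition east_dirichlet :: "real \<Rightarrow> nat \<Rightarrow> (nat set \<Rightarrow> real) \<Rightarrow> real" where
  "east_dirichlet q L f =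
     (\<Sum>x\<in>{1..L}. east_mean q L (\<lambda>A. east_c x A * east_local_var q x f A))"

definition east_gap :: "real \<Rightarrow> nat \<Rightarrow> real" where
  "east_gap q L = Inf {east_dirichlet q L f / east_var q L f | f.
                       \<exists>A\<in>east_conf L. \<exists>B\<in>east_conf L. f A \<noteq> f B}"

definition T_rel :: "real \<Rightarrow> nat \<Rightarrow> real" where
  "T_rel q L = 1 / east_gap q L"

end

theory Submission
  imports Defs "HOL-Library.Discrete_Functions"
begin

text \<open>Upper bound: if intervals of length \<open>l\<close> relax in time \<open>K\<close>, then waiting for a zero in the last
  \<open>m\<close> sites of such an interval relaxes length \<open>2 l + 1 - m\<close> in time of order \<open>K / (q m)\<close>. Taking
  \<open>m\<close> about \<open>l / n\<close> at each of \<open>n + 1\<close> doublings loses only a constant factor of length in total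
  and costs \<open>n ^ n / (q ^ n 2 ^ (n choose 2))\<close>.

  Lower bound: remove zeros deterministically, at stage \<open>g\<close> those at distance \<open>g\<close> from the previous
  zero, and use as test function the indicator that the site \<open>M = 2 ^ m\<close> survives all stages
  \<open>g < M\<close>. A legal flip at \<open>x\<close> changes this indicator only if the interval \<open>[x - 1, x]\<close> can be
  grown to \<open>[0, M]\<close> by successive jumps onto zeros, each jump no longer than the current interval.
  This needs at least \<open>m\<close> zeros. If the lengths are \<open>2 ^ i r i\<close>, then \<open>r\<close> decreases from \<open>1\<close>, so that
  their number is of order \<open>2 ^ (m choose 2) / m!\<close>, where the factorial is the volume of ordered
  sequences.\<close>

section \<open>Averages over finite sets of sites\<close>

text \<open>The conditional expectation over the sites of \<open>S\<close> given those outside, kept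
  as a function of the whole configuration so that averages over disjoint blocks compose.\<close>

definition avg :: "real \<Rightarrow> nat set \<Rightarrow> (nat set \<Rightarrow> real) \<Rightarrow> nat set \<Rightarrow> real" where
  "avg q S f A = (\<Sum>B\<in>Pow S. (1 - q) ^ card B * q ^ card (S - B) * f ((A - S) \<union> B))"

definition var :: "real \<Rightarrow> nat set \<Rightarrow> (nat set \<Rightarrow> real) \<Rightarrow> nat set \<Rightarrow> real" where
  "var q S f A = avg q S (\<lambda>B. (f B)\<^sup>2) A - (avg q S f A)\<^sup>2"

text \<open>Measurability with respect to the sites outside \<open>S\<close>; such functions act as
  constants under \<open>avg q S\<close>.\<close>

definition invariant_on :: "nat set \<Rightarrow> (nat set \<Rightarrow> 'a) \<Rightarrow> bool" where
  "invariant_on S f \<longleftrightarrow> (\<forall>A B. A - S = B - S \<longrightarrow> f A = f B)"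

lemma invariant_onD: "invariant_on S f \<Longrightarrow> A - S = B - S \<Longrightarrow> f A = f B"
  unfolding invariant_on_def by blast

lemma avg_empty [simp]: "avg q {} f A = f A"
  by (simp add: avg_def)

lemma avg_insert:
  assumes "finite S" "x \<notin> S"
  shows "avg q (insert x S) f A = (1 - q) * avg q S f (insert x A) + q * avg q S f (A - {x})"
proof -
  have inj: "inj_on (insert x) (Pow S)"
    using assms(2) by (auto simp: inj_on_def)
  have disj: "Pow S \<inter> insert x ` Pow S = {}"
    using assms(2) by auto
  have 1: "(\<Sum>B\<in>Pow S. (1 - q) ^ card (insert x B) * q ^ card (insert x S - insert x B)
            * f ((A - insert x S) \<union> insert x B)) = (1 - q) * avg q S f (insert x A)"
    unfolding avg_def sum_distrib_left
  proof (rule sum.cong[OF refl])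
    fix B assume B: "B \<in> Pow S"
    hence "finite B" "x \<notin> B" using assms finite_subset by auto
    moreover have "insert x S - insert x B = S - B" using assms B by auto
    moreover have "(A - insert x S) \<union> insert x B = (insert x A - S) \<union> B" using assms by auto
    ultimately show "(1 - q) ^ card (insert x B) * q ^ card (insert x S - insert x B)
        * f ((A - insert x S) \<union> insert x B)
      = (1 - q) * ((1 - q) ^ card B * q ^ card (S - B) * f ((insert x A - S) \<union> B))"
      by simp
  qed
  have 2: "(\<Sum>B\<in>Pow S. (1 - q) ^ card B * q ^ card (insert x S - B)
            * f ((A - insert x S) \<union> B)) = q * avg q S f (A - {x})"
    unfolding avg_def sum_distrib_left
  proof (rule sum.cong[OF refl])
    fix B assume B: "B \<in> Pow S"
    hence "insert x S - B = insert x (S - B)" "x \<notin> S - B" "finite (S - B)"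
      using assms by auto
    moreover have "(A - insert x S) \<union> B = (A - {x} - S) \<union> B" by auto
    ultimately show "(1 - q) ^ card B * q ^ card (insert x S - B) * f ((A - insert x S) \<union> B)
      = q * ((1 - q) ^ card B * q ^ card (S - B) * f ((A - {x} - S) \<union> B))"
      by simp
  qed
  have "avg q (insert x S) f A =
    (\<Sum>B\<in>Pow S. (1 - q) ^ card B * q ^ card (insert x S - B) * f ((A - insert x S) \<union> B))
    + (\<Sum>B\<in>insert x ` Pow S. (1 - q) ^ card B * q ^ card (insert x S - B) * f ((A - insert x S) \<union> B))"
    unfolding avg_def Pow_insert using assms disj by (subst sum.union_disjoint) auto
  thus ?thesis using 1 2 by (simp add: sum.reindex[OF inj])
qed

lemma avg_singleton: "avg q {x} f A = (1 - q) * f (insert x A) + q * f (A - {x})"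
  using avg_insert[of "{}" x q f A] by simp

lemma avg_union:
  assumes "finite S" "finite T" "S \<inter> T = {}"
  shows "avg q (S \<union> T) f A = avg q S (avg q T f) A"
  using assms
proof (induction S arbitrary: A rule: finite_induct)
  case (insert x S)
  hence "avg q (insert x S \<union> T) f A
      = (1 - q) * avg q (S \<union> T) f (insert x A) + q * avg q (S \<union> T) f (A - {x})"
    by (simp add: avg_insert)
  also have "\<dots> = (1 - q) * avg q S (avg q T f) (insert x A) + q * avg q S (avg q T f) (A - {x})"
    using insert by auto
  also have "\<dots> = avg q (insert x S) (avg q T f) A"
    using insert by (simp add: avg_insert)
  finally show ?case .
qed simp

lemma avg_commute:
  assumes "finite S" "finite T" "S \<inter> T = {}"
  shows "avg q S (avg q T f) A = avg q T (avg q S f) A"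
  using avg_union[OF assms, of q f A] avg_union[of T S q f A] assms by (simp add: Un_commute Int_commute)

lemma avg_add: "avg q S (\<lambda>B. f B + g B) A = avg q S f A + avg q S g A"
  by (simp add: avg_def distrib_left sum.distrib)

lemma avg_diff: "avg q S (\<lambda>B. f B - g B) A = avg q S f A - avg q S g A"
  by (simp add: avg_def right_diff_distrib sum_subtractf)

lemma avg_cmult: "avg q S (\<lambda>B. c * f B) A = c * avg q S f A"
  by (simp add: avg_def sum_distrib_left mult_ac)

lemma avg_sum: "avg q S (\<lambda>B. \<Sum>i\<in>I. f i B) A = (\<Sum>i\<in>I. avg q S (f i) A)"
  unfolding avg_def sum_distrib_left by (rule sum.swap)

lemma avg_const: "finite S \<Longrightarrow> avg q S (\<lambda>_. c) A = c"
  by (induction S arbitrary: A rule: finite_induct) (auto simp: avg_insert algebra_simps)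

lemma invariant_on_avg: "invariant_on S (avg q S f)"
  unfolding invariant_on_def avg_def by auto

lemma invariant_on_avg_other:
  assumes "invariant_on T f"
  shows "invariant_on T (avg q S f)"
  unfolding invariant_on_def avg_def
proof (intro allI impI sum.cong refl)
  fix A B C assume "A - T = B - T"
  hence "A - S \<union> C - T = B - S \<union> C - T" by auto
  thus "(1 - q) ^ card C * q ^ card (S - C) * f (A - S \<union> C)
      = (1 - q) ^ card C * q ^ card (S - C) * f (B - S \<union> C)"
    by (simp add: invariant_onD[OF assms, of "A - S \<union> C" "B - S \<union> C"])
qed

lemma avg_mult_invariant:
  assumes "invariant_on S g"
  shows "avg q S (\<lambda>B. g B * f B) A = g A * avg q S f A"
  unfolding avg_def sum_distrib_left
proof (rule sum.cong[OF refl])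
  fix B assume "B \<in> Pow S"
  hence "g (A - S \<union> B) = g A" by (intro invariant_onD[OF assms]) auto
  thus "(1 - q) ^ card B * q ^ card (S - B) * (g (A - S \<union> B) * f (A - S \<union> B))
      = g A * ((1 - q) ^ card B * q ^ card (S - B) * f (A - S \<union> B))" by simp
qed

lemma avg_of_invariant:
  assumes "finite S" "invariant_on S g"
  shows "avg q S g A = g A"
  using avg_mult_invariant[OF assms(2), of q "\<lambda>_. 1" A] avg_const[OF assms(1), of q 1 A] by simp

lemma avg_cong_invariant:
  assumes "\<And>B. B - S = A - S \<Longrightarrow> f B = g B"
  shows "avg q S f A = avg q S g A"
  unfolding avg_def by (intro sum.cong refl arg_cong2[where f = "(*)"] assms) auto

lemma var_eq_avg_square_sub:
  assumes "finite S"
  shows "avg q S (\<lambda>B. (f B - c)\<^sup>2) A = var q S f A + (avg q S f A - c)\<^sup>2"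
proof -
  have "avg q S (\<lambda>B. (f B - c)\<^sup>2) A = avg q S (\<lambda>B. (f B)\<^sup>2 + ((- 2 * c) * f B + c\<^sup>2)) A"
    by (simp add: power2_diff algebra_simps)
  also have "\<dots> = avg q S (\<lambda>B. (f B)\<^sup>2) A + (- 2 * c) * avg q S f A + c\<^sup>2"
    by (simp only: avg_add avg_cmult avg_const[OF assms])
  finally show ?thesis by (simp add: var_def power2_diff algebra_simps)
qed

lemma avg_square_sub_avg:
  assumes "finite S"
  shows "avg q S (\<lambda>B. (f B - avg q S f B)\<^sup>2) A = var q S f A"
proof -
  have "avg q S (\<lambda>B. (f B - avg q S f B)\<^sup>2) A = avg q S (\<lambda>B. (f B - avg q S f A)\<^sup>2) A"
  proof (rule avg_cong_invariant)
    fix B assume "B - S = A - S"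
    from invariant_onD[OF invariant_on_avg this, of q f]
    show "(f B - avg q S f B)\<^sup>2 = (f B - avg q S f A)\<^sup>2" by simp
  qed
  thus ?thesis using var_eq_avg_square_sub[OF assms, of q f "avg q S f A" A] by simp
qed

lemma invariant_on_var_other:
  assumes "invariant_on T f"
  shows "invariant_on T (var q S f)"
  unfolding invariant_on_def
proof (intro allI impI)
  fix A B assume AB: "A - T = B - T"
  have "invariant_on T (\<lambda>B. (f B)\<^sup>2)"
    using assms unfolding invariant_on_def by metis
  from invariant_onD[OF invariant_on_avg_other[OF this] AB, of q S]
    invariant_onD[OF invariant_on_avg_other[OF assms] AB, of q S]
  show "var q S f A = var q S f B"
    by (simp add: var_def)
qed

lemma invariant_on_var: "invariant_on S (var q S f)"
  unfolding invariant_on_def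
proof (intro allI impI)
  fix A B assume AB: "A - S = B - S"
  from invariant_onD[OF invariant_on_avg AB, of q f]
    invariant_onD[OF invariant_on_avg AB, of q "\<lambda>B. (f B)\<^sup>2"]
  show "var q S f A = var q S f B" by (simp add: var_def)
qed

text \<open>The law of total variance: by the tower property the averages of
  \<open>(avg q T f)\<^sup>2\<close> cancel.\<close>

lemma var_union:
  assumes "finite S" "finite T" "S \<inter> T = {}"
  shows "var q (S \<union> T) f A = avg q S (var q T f) A + var q S (avg q T f) A"
  unfolding var_def by (simp add: avg_union[OF assms] avg_diff)

section \<open>The East process in terms of block averages\<close>

lemma east_mean_eq_avg: "east_mean q L f = avg q {0<..L} f {}"
proof -
  have "{0<..L} = {1..L}" by auto
  moreover have "card ({1..L} - B) = L - card B" if "B \<subseteq> {1..L}" for B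
    using that by (simp add: card_Diff_subset finite_subset)
  ultimately show ?thesis
    unfolding east_mean_def avg_def east_conf_def east_pi_def by (auto intro!: sum.cong)
qed

lemma east_var_eq_var: "east_var q L f = var q {0<..L} f {}"
  unfolding east_var_def east_mean_eq_avg by (simp add: var_eq_avg_square_sub)

lemma east_local_var_eq_var: "east_local_var q x f A = var q {x} f A"
  unfolding east_local_var_def var_def avg_singleton Let_def
  by (simp add: algebra_simps power2_eq_square)

text \<open>Site \<open>a\<close> acts as a frozen zero to the left of the block, so its first site
  \<open>Suc a\<close> is always free; \<open>a = 0\<close> gives the East process itself.\<close>

definition constraint :: "nat \<Rightarrow> nat \<Rightarrow> nat set \<Rightarrow> real" where
  "constraint a x A = (if x = Suc a then 1 else if x - 1 \<in> A then 0 else 1)"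

definition dirichlet :: "real \<Rightarrow> nat \<Rightarrow> nat \<Rightarrow> (nat set \<Rightarrow> real) \<Rightarrow> nat set \<Rightarrow> real" where
  "dirichlet q a b f A = (\<Sum>x\<in>{a<..b}. avg q {a<..b} (\<lambda>B. constraint a x B * var q {x} f B) A)"

lemma east_dirichlet_eq: "east_dirichlet q L f = dirichlet q 0 L f {}"
proof -
  have "{0<..L} = {1..L}" by auto
  moreover have "east_c x B = constraint 0 x B" for x B
    by (simp add: east_c_def constraint_def)
  ultimately show ?thesis
    unfolding east_dirichlet_def dirichlet_def east_mean_eq_avg east_local_var_eq_var by simp
qed

lemma constraint_nonneg: "0 \<le> constraint a x A"
  by (simp add: constraint_def)

locale bernoulli =
  fixes q :: real
  assumes q_pos: "0 < q" and q_half: "q < 1/2"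
begin

lemma avg_mono:
  assumes "\<And>B. B - S = A - S \<Longrightarrow> f B \<le> g B"
  shows "avg q S f A \<le> avg q S g A"
  unfolding avg_def using q_pos q_half
  by (intro sum_mono mult_left_mono assms mult_nonneg_nonneg zero_le_power) auto

lemma avg_nonneg: "(\<And>B. 0 \<le> f B) \<Longrightarrow> 0 \<le> avg q S f A"
  unfolding avg_def using q_pos q_half
  by (intro sum_nonneg mult_nonneg_nonneg zero_le_power) auto

lemma var_nonneg: "finite S \<Longrightarrow> 0 \<le> var q S f A"
  using avg_nonneg[of "\<lambda>B. (f B - avg q S f B)\<^sup>2" S A] by (simp add: avg_square_sub_avg)

lemma var_le_avg_square_sub: "finite S \<Longrightarrow> var q S f A \<le> avg q S (\<lambda>B. (f B - c)\<^sup>2) A"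
  by (simp add: var_eq_avg_square_sub)

lemma avg_var_le_var:
  assumes "finite S" "finite T" "S \<inter> T = {}"
  shows "avg q S (var q T f) A \<le> var q (S \<union> T) f A"
  using var_union[OF assms, of q f A] var_nonneg[OF assms(1), of "avg q T f" A] by simp

lemma dirichlet_nonneg: "0 \<le> dirichlet q a b f A"
  unfolding dirichlet_def
  by (intro sum_nonneg avg_nonneg mult_nonneg_nonneg constraint_nonneg var_nonneg) auto

text \<open>Bound \<open>var Y (avg X f)\<close> by comparing \<open>avg X f\<close> with \<open>avg Y f\<close> through \<open>f\<close> itself, at an
  \<open>X\<close>-configuration drawn from the event \<open>e\<close>.\<close>

lemma var_block_le:
  assumes "finite X" "finite Y" "X \<inter> Y = {}"
    and e: "\<And>B. 0 \<le> e B" "\<And>B. e B \<le> 1"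
    and eps: "\<And>A. avg q X e A = \<epsilon>" "0 < \<epsilon>"
  shows "var q (X \<union> Y) f A \<le> (3 / \<epsilon>) * (avg q Y (var q X f) A + avg q X (\<lambda>B. e B * var q Y f B) A)"
proof -
  let ?h = "avg q X f"
  have "\<epsilon> = avg q X e A" using eps by simp
  also have "\<dots> \<le> avg q X (\<lambda>_. 1) A" by (rule avg_mono) (rule e)
  finally have eps1: "\<epsilon> \<le> 1" using assms(1) by (simp add: avg_const)
  have pointwise: "var q Y ?h B \<le> 2 * avg q Y (\<lambda>C. (f C - ?h C)\<^sup>2) B + 2 * var q Y f B" for B
  proof -
    let ?c = "avg q Y f B"
    have "var q Y ?h B \<le> avg q Y (\<lambda>C. (?h C - ?c)\<^sup>2) B"
      by (rule var_le_avg_square_sub[OF assms(2)])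
    also have "\<dots> \<le> avg q Y (\<lambda>C. 2 * (f C - ?h C)\<^sup>2 + 2 * (f C - ?c)\<^sup>2) B"
    proof (rule avg_mono)
      fix C
      have "0 \<le> ((f C - ?h C) + (f C - ?c))\<^sup>2" by simp
      thus "(?h C - ?c)\<^sup>2 \<le> 2 * (f C - ?h C)\<^sup>2 + 2 * (f C - ?c)\<^sup>2"
        by (simp add: power2_eq_square algebra_simps)
    qed
    also have "\<dots> = 2 * avg q Y (\<lambda>C. (f C - ?h C)\<^sup>2) B + 2 * var q Y f B"
      using assms(2) by (simp add: avg_add avg_cmult var_eq_avg_square_sub)
    finally show ?thesis .
  qed
  \<comment> \<open>\<open>?h\<close> ignores the sites of \<open>X\<close>, so weighting its
    \<open>Y\<close>-variance by \<open>e\<close> only costs the factor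
    \<open>\<epsilon>\<close>.\<close>
  have inv: "invariant_on X (var q Y ?h)"
    by (rule invariant_on_var_other[OF invariant_on_avg])
  have "\<epsilon> * var q Y ?h A = avg q X (\<lambda>B. var q Y ?h B * e B) A"
    using avg_mult_invariant[OF inv, of q e A] eps by simp
  \<comment> \<open>The event is dropped from the first term, using \<open>e \<le> 1\<close>, and
    kept in front of \<open>var q Y f\<close>, where it will release the sites of
    \<open>Y\<close>.\<close>
  also have "\<dots> \<le> avg q X (\<lambda>B. 2 * avg q Y (\<lambda>C. (f C - ?h C)\<^sup>2) B + 2 * (e B * var q Y f B)) A"
  proof (rule avg_mono)
    fix B
    have "var q Y ?h B * e B \<le> (2 * avg q Y (\<lambda>C. (f C - ?h C)\<^sup>2) B + 2 * var q Y f B) * e B"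
      by (rule mult_right_mono[OF pointwise e(1)])
    moreover have "avg q Y (\<lambda>C. (f C - ?h C)\<^sup>2) B * e B \<le> avg q Y (\<lambda>C. (f C - ?h C)\<^sup>2) B * 1"
      by (rule mult_left_mono[OF e(2)]) (rule avg_nonneg, simp)
    ultimately show "var q Y ?h B * e B
        \<le> 2 * avg q Y (\<lambda>C. (f C - ?h C)\<^sup>2) B + 2 * (e B * var q Y f B)"
      by (simp add: algebra_simps)
  qed
  also have "\<dots> = 2 * avg q X (avg q Y (\<lambda>C. (f C - ?h C)\<^sup>2)) A + 2 * avg q X (\<lambda>B. e B * var q Y f B) A"
    by (simp add: avg_add avg_cmult)
  also have "avg q X (avg q Y (\<lambda>C. (f C - ?h C)\<^sup>2)) A = avg q Y (var q X f) A"
  proof -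
    have "avg q X (\<lambda>C. (f C - ?h C)\<^sup>2) = var q X f"
      using avg_square_sub_avg[OF assms(1)] by (intro ext) simp
    thus ?thesis using avg_commute[OF assms(1,2,3), of q "\<lambda>C. (f C - ?h C)\<^sup>2" A] by simp
  qed
  finally have 1: "var q Y ?h A \<le> (2 * avg q Y (var q X f) A + 2 * avg q X (\<lambda>B. e B * var q Y f B) A) / \<epsilon>"
    using eps(2) by (simp add: field_simps)
  have 2: "var q (X \<union> Y) f A = avg q Y (var q X f) A + var q Y ?h A"
    using var_union[of Y X q f A] assms by (simp add: Un_commute Int_commute)
  \<comment> \<open>Since \<open>\<epsilon> \<le> 1\<close>, the coefficient
    \<open>1 + 2 / \<epsilon>\<close> of this term is at most \<open>3 / \<epsilon>\<close>.\<close>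
  have 3: "avg q Y (var q X f) A \<le> avg q Y (var q X f) A / \<epsilon>"
  proof -
    have "0 \<le> avg q Y (var q X f) A" by (rule avg_nonneg) (rule var_nonneg[OF assms(1)])
    thus ?thesis using eps(2) eps1 by (simp add: pos_le_divide_eq mult_right_le_one_le)
  qed
  have 4: "0 \<le> avg q X (\<lambda>B. e B * var q Y f B) A / \<epsilon>"
    using eps(2) e(1) var_nonneg[OF assms(2)] by (intro divide_nonneg_pos avg_nonneg) auto
  show ?thesis using 1 2 3 4 by (simp add: add_divide_distrib distrib_left)
qed


lemma avg_all_ones:
  assumes "finite S" "W \<subseteq> S"
  shows "avg q S (\<lambda>B. if W \<subseteq> B then 1 else 0) A = (1 - q) ^ card W"
proof -
  have fin: "finite W" "finite (S - W)" using assms finite_subset by auto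
  have "avg q W (\<lambda>B. if W \<subseteq> B then 1 else 0) = (\<lambda>_. (1 - q) ^ card W)"
  proof
    fix B
    have "avg q W (\<lambda>B. if W \<subseteq> B then 1 else 0) B = (\<Sum>C\<in>Pow W. if C = W then (1 - q) ^ card W else 0)"
      unfolding avg_def by (intro sum.cong refl) (auto simp: Un_absorb1)
    thus "avg q W (\<lambda>B. if W \<subseteq> B then 1 else 0) B = (1 - q) ^ card W" using fin by simp
  qed
  moreover have "avg q S (\<lambda>B. if W \<subseteq> B then 1 else 0) A
      = avg q (S - W) (avg q W (\<lambda>B. if W \<subseteq> B then 1 else 0)) A"
    using avg_union[OF fin(2,1), of q _ A] assms(2) by (simp add: Un_absorb2 Int_commute)
  ultimately show ?thesis by (simp add: avg_const[OF fin(2)])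
qed

section \<open>Poincare inequalities by doubling\<close>

text \<open>\<open>K\<close> bounds the relaxation time uniformly in the position of the block, its
  length up to \<open>l\<close> and the configuration outside it. This uniformity permits
  conditioning on a zero inside a larger block.\<close>

definition poincare :: "nat \<Rightarrow> real \<Rightarrow> bool" where
  "poincare l K \<longleftrightarrow> (\<forall>a b f A. a \<le> b \<and> b \<le> a + l \<longrightarrow> var q {a<..b} f A \<le> K * dirichlet q a b f A)"

lemma poincareD: "poincare l K \<Longrightarrow> a \<le> b \<Longrightarrow> b \<le> a + l \<Longrightarrow> var q {a<..b} f A \<le> K * dirichlet q a b f A"
  unfolding poincare_def by blast

lemma poincare_mono:
  assumes "poincare l K" "K \<le> K'"
  shows "poincare l K'"
  unfolding poincare_def
proof (intro allI impI)
  fix a b f A assume "a \<le> b \<and> b \<le> a + l"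
  hence "var q {a<..b} f A \<le> K * dirichlet q a b f A" using poincareD[OF assms(1)] by blast
  also have "\<dots> \<le> K' * dirichlet q a b f A"
    by (rule mult_right_mono[OF assms(2) dirichlet_nonneg])
  finally show "var q {a<..b} f A \<le> K' * dirichlet q a b f A" .
qed

lemma poincare_1: "poincare 1 1"
  unfolding poincare_def
proof (intro allI impI)
  fix a b :: nat and f A assume ab: "a \<le> b \<and> b \<le> a + 1"
  show "var q {a<..b} f A \<le> 1 * dirichlet q a b f A"
  proof (cases "b = a")
    case True
    thus ?thesis by (simp add: var_def dirichlet_def)
  next
    case False
    hence b: "b = Suc a" using ab by simp
    have "{a<..Suc a} = {Suc a}" by auto
    thus ?thesis unfolding b dirichlet_def
      using avg_of_invariant[OF _ invariant_on_var, of "{Suc a}" q q f A] by (simp add: constraint_def)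
  qed
qed

definition first_zero :: "nat \<Rightarrow> nat \<Rightarrow> nat set \<Rightarrow> real" where
  "first_zero u y B = (if y \<notin> B \<and> {u<..<y} \<subseteq> B then 1 else 0)"

lemma first_zero_nonneg: "0 \<le> first_zero u y B"
  by (simp add: first_zero_def)

text \<open>If the window contains a zero, exactly the term of its leftmost zero equals 1.\<close>

lemma sum_first_zero:
  "(\<Sum>y\<in>{u<..c}. first_zero u y B) = (if {u<..c} \<subseteq> B then 0 else 1)"
proof (cases "{u<..c} \<subseteq> B")
  case True
  thus ?thesis by (auto simp: first_zero_def intro!: sum.neutral)
next
  case False
  define z where "z = Min ({u<..c} - B)"
  have ne: "finite ({u<..c} - B)" "{u<..c} - B \<noteq> {}" using False by auto
  have z: "z \<in> {u<..c}" "z \<notin> B" using Min_in[OF ne] by (auto simp: z_def)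
  have below: "{u<..<z} \<subseteq> B"
  proof
    fix y assume y: "y \<in> {u<..<z}"
    show "y \<in> B"
    proof (rule ccontr)
      assume "y \<notin> B"
      hence "z \<le> y" using y z(1) ne(1) by (auto simp: z_def intro!: Min_le)
      thus False using y by simp
    qed
  qed
  have "first_zero u y B = (if y = z then 1 else 0)" if "y \<in> {u<..c}" for y
    using that z below by (cases y z rule: linorder_cases) (auto simp: first_zero_def)
  hence "(\<Sum>y\<in>{u<..c}. first_zero u y B) = (\<Sum>y\<in>{u<..c}. if y = z then 1 else 0)"
    by (intro sum.cong) auto
  thus ?thesis using False z(1) by simp
qed

text \<open>The event that \<open>y\<close> is the first zero is decided by sites up to
  \<open>y\<close>, so given it the sites \<open>{y<..b}\<close> are still independent and form a
  block with zero boundary of length at most \<open>l\<close>. Its variance dominates the averaged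
  variance on \<open>{c<..b}\<close>, and \<open>poincare l K\<close> applies to it.\<close>

lemma avg_first_zero_var_le:
  assumes P: "poincare l K" and "a \<le> u" "u < y" "y \<le> c" "c \<le> b" "b \<le> y + l" "0 \<le> K"
  shows "avg q {a<..b} (\<lambda>B. first_zero u y B * var q {c<..b} f B) A
    \<le> K * (\<Sum>x\<in>{a<..b}. avg q {a<..b} (\<lambda>B. first_zero u y B * (constraint a x B * var q {x} f B)) A)"
proof -
  let ?Z = "{y<..b}" and ?g = "\<lambda>x B. first_zero u y B * (constraint a x B * var q {x} f B)"
  have S: "avg q {a<..b} g A = avg q {a<..y} (avg q ?Z g) A" for g
  proof -
    have "{a<..y} \<union> ?Z = {a<..b}" using assms by auto
    moreover have "{a<..y} \<inter> ?Z = {}" by auto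
    ultimately show ?thesis using avg_union[of "{a<..y}" ?Z q g A] by simp
  qed
  have Z: "{y<..c} \<union> {c<..b} = ?Z" "{y<..c} \<inter> {c<..b} = {}" using assms by auto
  have inv: "invariant_on ?Z (first_zero u y)"
    unfolding invariant_on_def
  proof (intro allI impI)
    fix A B :: "nat set" assume AB: "A - ?Z = B - ?Z"
    have "v \<in> A \<longleftrightarrow> v \<in> B" if "v \<le> y" for v
    proof -
      have "v \<in> A - ?Z \<longleftrightarrow> v \<in> B - ?Z" using AB by simp
      thus ?thesis using that by simp
    qed
    thus "first_zero u y A = first_zero u y B" unfolding first_zero_def by (auto simp: subset_eq)
  qed
  have "avg q ?Z (\<lambda>B. first_zero u y B * var q {c<..b} f B) B \<le> K * (\<Sum>x\<in>{a<..b}. avg q ?Z (?g x) B)" for B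
  proof -
    have "avg q ?Z (\<lambda>B. first_zero u y B * var q {c<..b} f B) B
        = first_zero u y B * avg q ?Z (var q {c<..b} f) B"
      by (rule avg_mult_invariant[OF inv])
    also have "avg q ?Z (var q {c<..b} f) B = avg q {y<..c} (var q {c<..b} f) B"
    proof -
      have "avg q {c<..b} (var q {c<..b} f) = var q {c<..b} f"
        by (intro ext avg_of_invariant invariant_on_var) simp
      thus ?thesis using avg_union[of "{y<..c}" "{c<..b}" q "var q {c<..b} f" B] Z by simp
    qed
    also have "first_zero u y B * \<dots> \<le> first_zero u y B * var q ?Z f B"
      using avg_var_le_var[of "{y<..c}" "{c<..b}" f B] Z
      by (intro mult_left_mono first_zero_nonneg) simp
    also have "\<dots> \<le> first_zero u y B * (K * dirichlet q y b f B)"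
      using assms by (intro mult_left_mono first_zero_nonneg poincareD[OF P]) auto
    also have "\<dots> = K * (\<Sum>x\<in>?Z. first_zero u y B * avg q ?Z (\<lambda>B. constraint y x B * var q {x} f B) B)"
      by (simp add: dirichlet_def sum_distrib_left mult_ac)
    also have "\<dots> \<le> K * (\<Sum>x\<in>?Z. avg q ?Z (?g x) B)"
    proof (intro mult_left_mono sum_mono)
      fix x assume x: "x \<in> ?Z"
      have "first_zero u y B * avg q ?Z (\<lambda>B. constraint y x B * var q {x} f B) B
          = avg q ?Z (\<lambda>B. first_zero u y B * (constraint y x B * var q {x} f B)) B"
        by (rule avg_mult_invariant[OF inv, symmetric])
      \<comment> \<open>The two constraints can differ only at \<open>x = Suc y\<close>, and there
        the zero at \<open>y\<close> makes both equal to 1.\<close>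
      also have "\<dots> \<le> avg q ?Z (?g x) B"
        using x assms by (intro avg_mono) (auto simp: first_zero_def constraint_def)
      finally show "first_zero u y B * avg q ?Z (\<lambda>B. constraint y x B * var q {x} f B) B
          \<le> avg q ?Z (?g x) B" .
    qed (use assms in simp)
    also have "\<dots> \<le> K * (\<Sum>x\<in>{a<..b}. avg q ?Z (?g x) B)"
      using assms by (intro mult_left_mono sum_mono2 avg_nonneg mult_nonneg_nonneg
          first_zero_nonneg constraint_nonneg var_nonneg) auto
    finally show ?thesis .
  qed
  hence "avg q {a<..y} (avg q ?Z (\<lambda>B. first_zero u y B * var q {c<..b} f B)) A
      \<le> avg q {a<..y} (\<lambda>B. K * (\<Sum>x\<in>{a<..b}. avg q ?Z (?g x) B)) A"
    by (rule avg_mono)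
  thus ?thesis by (simp add: S avg_cmult avg_sum)
qed

text \<open>The leftmost zero of the window \<open>{a + l - m<..a + l}\<close> unblocks all sites to its right, and
  conditioning on its position leaves those sites independent.\<close>

lemma poincare_double:
  assumes P: "poincare l K" and "0 \<le> K" "1 \<le> m" "m \<le> l"
  shows "poincare (2 * l + 1 - m) (6 * K / (1 - (1 - q) ^ m))"
  unfolding poincare_def
proof (intro allI impI)
  fix a b f A assume ab: "a \<le> b \<and> b \<le> a + (2 * l + 1 - m)"
  define \<epsilon> where "\<epsilon> = 1 - (1 - q) ^ m"
  have "(1 - q) ^ m \<le> (1 - q) ^ 1"
    using assms q_pos q_half by (intro power_decreasing) auto
  hence eps: "0 < \<epsilon>" "\<epsilon> \<le> 1" using q_pos q_half by (auto simp: \<epsilon>_def)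
  let ?D = "dirichlet q a b f A"
  show "var q {a<..b} f A \<le> 6 * K / (1 - (1 - q) ^ m) * ?D"
  proof (cases "b \<le> a + l")
    case True
    have "K \<le> K / \<epsilon>" using eps assms by (simp add: pos_le_divide_eq mult_right_le_one_le)
    also have "\<dots> \<le> 6 * K / \<epsilon>" using eps assms(2) by (intro divide_right_mono) auto
    finally have "K \<le> 6 * K / \<epsilon>" .
    from mult_right_mono[OF this dirichlet_nonneg, of a b f A] poincareD[OF P, of a b f A] True ab
    show ?thesis by (simp add: \<epsilon>_def)
  next
    case False
    define c where "c = a + l"
    define u where "u = c - m"
    define X Y where "X = {a<..c}" and "Y = {c<..b}"
    define g where "g x B = constraint a x B * var q {x} f B" for x B
    have g_nonneg: "0 \<le> g x B" for x B
      unfolding g_def by (intro mult_nonneg_nonneg constraint_nonneg var_nonneg) simp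
    have XY: "X \<union> Y = {a<..b}" "X \<inter> Y = {}" "finite X" "finite Y" "Y \<inter> X = {}" "Y \<union> X = {a<..b}"
      using False by (auto simp: X_def Y_def c_def)
    have cu: "a \<le> u" "u + m = c" using assms by (auto simp: c_def u_def)
    define e where "e B = (if {u<..c} \<subseteq> B then 0 else 1 :: real)" for B
    have "avg q X e C = \<epsilon>" for C
    proof -
      have "avg q X e C = avg q X (\<lambda>B. 1 - (if {u<..c} \<subseteq> B then 1 else 0)) C"
        by (rule avg_cong_invariant) (simp add: e_def)
      also have "\<dots> = 1 - (1 - q) ^ card {u<..c}"
        using avg_all_ones[of X "{u<..c}" C] cu XY(3) by (simp add: avg_diff avg_const X_def subset_eq)
      also have "card {u<..c} = m" using cu(2) by simp
      finally show ?thesis by (simp add: \<epsilon>_def)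
    qed
    hence block: "var q {a<..b} f A
        \<le> 3 / \<epsilon> * (avg q Y (var q X f) A + avg q X (\<lambda>B. e B * var q Y f B) A)"
      using var_block_le[OF XY(3,4,2), of e \<epsilon> f A] eps XY(1) by (auto simp: e_def)
    have D: "?D = (\<Sum>x\<in>{a<..b}. avg q {a<..b} (g x) A)"
      by (simp add: dirichlet_def g_def[abs_def])
    have "avg q Y (var q X f) A \<le> avg q Y (\<lambda>B. K * dirichlet q a c f B) A"
      unfolding X_def by (intro avg_mono poincareD[OF P]) (auto simp: c_def)
    also have "\<dots> = K * (\<Sum>x\<in>X. avg q {a<..b} (g x) A)"
    proof -
      have "avg q Y (avg q X (g x)) A = avg q {a<..b} (g x) A" for x
        using avg_union[OF XY(4,3,5), of q "g x" A] XY(6) by simp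
      thus ?thesis by (simp add: dirichlet_def avg_cmult avg_sum g_def[abs_def] X_def)
    qed
    also have "\<dots> \<le> K * ?D"
      unfolding D using XY(1) assms(2) by (intro mult_left_mono sum_mono2 avg_nonneg g_nonneg) auto
    finally have V1: "avg q Y (var q X f) A \<le> K * ?D" .
    have "invariant_on Y (\<lambda>B. e B * var q Y f B)"
      unfolding invariant_on_def
    proof (intro allI impI)
      fix B C :: "nat set" assume BC: "B - Y = C - Y"
      hence "var q Y f B = var q Y f C" by (rule invariant_onD[OF invariant_on_var])
      moreover have "v \<in> B \<longleftrightarrow> v \<in> C" if "v \<le> c" for v
      proof -
        have "v \<in> B - Y \<longleftrightarrow> v \<in> C - Y" using BC by simp
        thus ?thesis using that by (simp add: Y_def)
      qed
      ultimately show "e B * var q Y f B = e C * var q Y f C" by (auto simp: e_def subset_eq)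
    qed
    hence "avg q Y (\<lambda>B. e B * var q Y f B) = (\<lambda>B. e B * var q Y f B)"
      by (intro ext avg_of_invariant XY)
    hence "avg q X (\<lambda>B. e B * var q Y f B) A = avg q {a<..b} (\<lambda>B. e B * var q Y f B) A"
      using avg_union[OF XY(3,4,2), of q "\<lambda>B. e B * var q Y f B" A] XY(1) by simp
    also have "\<dots> = (\<Sum>y\<in>{u<..c}. avg q {a<..b} (\<lambda>B. first_zero u y B * var q Y f B) A)"
      by (simp add: e_def flip: sum_first_zero avg_sum sum_distrib_right)
    \<comment> \<open>Every \<open>y\<close> in the window is at least \<open>a + l - m + 1\<close>,
      so \<open>b - y \<le> l\<close>; this is what allows the new length
      \<open>2 * l + 1 - m\<close>.\<close>
    also have "\<dots> \<le> (\<Sum>y\<in>{u<..c}. K * (\<Sum>x\<in>{a<..b}. avg q {a<..b} (\<lambda>B. first_zero u y B * g x B) A))"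
      unfolding g_def Y_def using cu ab False assms
      by (intro sum_mono avg_first_zero_var_le[OF P]) (auto simp: c_def)
    also have "\<dots> = K * (\<Sum>x\<in>{a<..b}. avg q {a<..b} (\<lambda>B. \<Sum>y\<in>{u<..c}. first_zero u y B * g x B) A)"
      by (subst sum_distrib_left[symmetric], subst sum.swap) (simp add: avg_sum)
    \<comment> \<open>The events for distinct \<open>y\<close> are disjoint, so the whole window
      costs the Dirichlet form only once.\<close>
    also have "\<dots> \<le> K * ?D"
      unfolding D using assms(2)
      by (intro mult_left_mono sum_mono avg_mono)
        (auto simp: sum_first_zero g_nonneg simp flip: sum_distrib_right)
    finally have V2: "avg q X (\<lambda>B. e B * var q Y f B) A \<le> K * ?D" .
    \<comment> \<open>The factor 6 is the 3 of the block estimate times its two terms.\<close>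
    have "3 / \<epsilon> * (avg q Y (var q X f) A + avg q X (\<lambda>B. e B * var q Y f B) A)
        \<le> 3 / \<epsilon> * (K * ?D + K * ?D)"
      using V1 V2 eps by (intro mult_left_mono add_mono) auto
    also have "\<dots> = 6 * K / \<epsilon> * ?D" by simp
    finally show ?thesis using block by (simp add: \<epsilon>_def)
  qed
qed

text \<open>Each doubling with a window of about \<open>l / N\<close> loses a share of order
  \<open>1 / N\<close> of the length, so \<open>N\<close> doublings lose at most one half. While
  \<open>q * 2 ^ k \<le> h\<close> a window contains a zero with probability of order
  \<open>q * m\<close>, so step \<open>k\<close> costs at most
  \<open>12 * (1 + h) * N / (q * 2 ^ k)\<close>; the powers of 2 multiply to
  \<open>2 ^ (k choose 2)\<close>.\<close>

lemma poincare_iterate: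
  assumes "0 < N" "\<And>k. k < N \<Longrightarrow> q * 2 ^ k \<le> h" "k \<le> N"
  shows "\<exists>l. 1 \<le> l \<and> l \<le> 2 ^ k \<and> 2 ^ k * (1 - real k / (2 * real N)) \<le> real l
      \<and> poincare l ((12 * (1 + h) * real N / q) ^ k / 2 ^ (k choose 2))"
  using assms(3)
proof (induction k)
  case 0
  show ?case using poincare_1 by (intro exI[of _ 1]) (simp add: numeral_2_eq_2)
next
  case (Suc k)
  then obtain l where l: "1 \<le> l" "l \<le> 2 ^ k" "2 ^ k * (1 - real k / (2 * real N)) \<le> real l"
    and P: "poincare l ((12 * (1 + h) * real N / q) ^ k / 2 ^ (k choose 2))" (is "poincare l ?K")
    by auto
  have h: "0 < h" using assms(2)[of 0] assms(1) q_pos by simp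
  define m where "m = nat \<lceil>real l / real N\<rceil>"
  have N: "1 \<le> real N" using assms(1) by simp
  have lN: "0 < real l / real N" "real l / real N \<le> real l"
    using l(1) N by (auto simp: field_simps)
  have m: "real l / real N \<le> real m" "real m < real l / real N + 1"
    using lN(1) unfolding m_def by linarith+
  have "0 < real m" using lN m by linarith
  hence m1: "1 \<le> m" by simp
  have ml: "m \<le> l" using lN(2) by (simp add: m_def)
  have K0: "0 \<le> ?K" using h q_pos by simp
  have half: "1 / 2 \<le> 1 - real k / (2 * real N)"
    using Suc.prems N by (simp add: field_simps)
  have "real m \<ge> 2 ^ k / (2 * real N)"
  proof -
    have "2 ^ k * (1 / 2) \<le> (2::real) ^ k * (1 - real k / (2 * real N))"
      using half by (intro mult_left_mono) auto
    hence "2 ^ k / 2 \<le> real l" using l(3) by linarith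
    hence "2 ^ k / 2 / real N \<le> real l / real N" using N by (intro divide_right_mono) auto
    thus ?thesis using m(1) by simp
  qed
  hence mlow: "2 ^ k \<le> 2 * real N * real m" using N by (simp add: field_simps)
  have "real m \<le> real (2 ^ k)" using ml l(2) by (simp only: of_nat_le_iff)
  hence "q * real m \<le> q * 2 ^ k" using q_pos by simp
  hence qm: "q * real m \<le> h" using assms(2)[of k] Suc.prems by simp
  define \<epsilon> where "\<epsilon> = 1 - (1 - q) ^ m"
  \<comment> \<open>Bernoulli's inequality with \<open>(1 - q) * (1 + q) \<le> 1\<close> gives
    \<open>q * m / (1 + q * m) \<le> \<epsilon>\<close>, which stays sharp up to constants as long
    as \<open>q * m\<close> is bounded.\<close>
  have "(1 - q) ^ m * (1 + real m * q) \<le> (1 - q) ^ m * (1 + q) ^ m"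
    using Bernoulli_inequality[of q m] q_pos q_half by (intro mult_left_mono) auto
  also have "\<dots> = (1 - q\<^sup>2) ^ m"
    by (simp add: power_mult_distrib[symmetric] power2_eq_square algebra_simps)
  also have "\<dots> \<le> 1" using q_pos q_half by (intro power_le_one) (auto simp: power2_eq_square mult_le_one)
  finally have "(1 - q) ^ m * (1 + real m * q) \<le> 1" .
  hence "q * real m \<le> \<epsilon> * (1 + q * real m)" by (simp add: \<epsilon>_def algebra_simps)
  also have "\<dots> \<le> \<epsilon> * (1 + h)"
    using qm q_pos q_half by (intro mult_left_mono) (auto simp: \<epsilon>_def power_le_one)
  finally have eps: "q * real m \<le> \<epsilon> * (1 + h)" .
  moreover have "0 < q * real m" using q_pos m1 by simp
  ultimately have "0 < \<epsilon> * (1 + h)" by linarith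
  hence eps_pos: "0 < \<epsilon>" using h by (simp add: zero_less_mult_iff)
  have "q * 2 ^ k \<le> q * (2 * real N * real m)" using mlow q_pos by (intro mult_left_mono) auto
  also have "\<dots> \<le> 2 * real N * (\<epsilon> * (1 + h))" using mult_left_mono[OF eps, of "2 * real N"] N by (simp add: mult_ac)
  finally have "6 / \<epsilon> \<le> 12 * (1 + h) * real N / q / 2 ^ k"
    using eps_pos q_pos by (simp add: field_simps)
  from mult_left_mono[OF this K0]
  have "6 * ?K / \<epsilon> \<le> ?K * (12 * (1 + h) * real N / q / 2 ^ k)" by (simp add: mult_ac)
  also have "\<dots> = (12 * (1 + h) * real N / q) ^ Suc k / 2 ^ (Suc k choose 2)"
    by (simp add: numeral_2_eq_2 power_add field_simps)
  finally have P': "poincare (2 * l + 1 - m) ((12 * (1 + h) * real N / q) ^ Suc k / 2 ^ (Suc k choose 2))"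
    using poincare_mono[OF poincare_double[OF P K0 m1 ml]] by (simp add: \<epsilon>_def)
  \<comment> \<open>As \<open>m < l / N + 1\<close>, the new length exceeds
    \<open>(2 - 1 / N) * l\<close>; the additive 1 in \<open>2 * l + 1 - m\<close> absorbs the
    rounding of \<open>m\<close>.\<close>
  have "2 ^ Suc k * (1 - real (Suc k) / (2 * real N))
      \<le> (2 - 1 / real N) * (2 ^ k * (1 - real k / (2 * real N)))"
  proof -
    have "(2 - 1 / real N) * (1 - real k / (2 * real N))
        = 2 * (1 - real (Suc k) / (2 * real N)) + real k / (2 * real N * real N)"
      using N by (simp add: field_simps)
    hence "2 * (1 - real (Suc k) / (2 * real N)) \<le> (2 - 1 / real N) * (1 - real k / (2 * real N))"
      by simp
    from mult_left_mono[OF this, of "2 ^ k"] show ?thesis by (simp add: mult_ac)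
  qed
  also have "\<dots> \<le> (2 - 1 / real N) * real l"
    using N by (intro mult_left_mono l(3)) (simp add: field_simps)
  also have "\<dots> \<le> real (2 * l + 1 - m)"
    using m(2) ml by (simp add: of_nat_diff algebra_simps)
  finally have "2 ^ Suc k * (1 - real (Suc k) / (2 * real N)) \<le> real (2 * l + 1 - m)" .
  moreover have "1 \<le> 2 * l + 1 - m" "2 * l + 1 - m \<le> 2 ^ Suc k" using ml m1 l(2) by auto
  ultimately show ?case using P' by blast
qed

section \<open>Variational bounds on the spectral gap\<close>

lemma east_var_pos:
  assumes "A \<in> east_conf L" "B \<in> east_conf L" "f A \<noteq> f B"
  shows "0 < east_var q L f"
proof -
  let ?t = "\<lambda>A. east_pi q L A * (f A - east_mean q L f)\<^sup>2"
  have fin: "finite (east_conf L)" by (simp add: east_conf_def)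
  have pi: "0 < east_pi q L A" for A using q_pos q_half by (simp add: east_pi_def)
  have nn: "0 \<le> ?t A" for A using pi[of A] by (intro mult_nonneg_nonneg) auto
  have "f A \<noteq> east_mean q L f \<or> f B \<noteq> east_mean q L f" using assms(3) by auto
  then obtain C where C: "C \<in> east_conf L" "f C \<noteq> east_mean q L f" using assms by blast
  hence "0 < ?t C" using pi[of C] by simp
  also have "?t C \<le> sum ?t (east_conf L)"
    by (rule member_le_sum[OF C(1) nn fin])
  finally show ?thesis unfolding east_var_def east_mean_def .
qed

lemma east_gap_ge:
  assumes "poincare l K" "0 < K" "1 \<le> L" "L \<le> l"
  shows "1 / K \<le> east_gap q L"
  unfolding east_gap_def
proof (rule cInf_greatest)
  \<comment> \<open>The number of ones is a non-constant function, so the infimum is over a nonempty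
    set.\<close>
  have "{} \<in> east_conf L" "{1} \<in> east_conf L" using assms(3) by (auto simp: east_conf_def)
  hence "\<exists>A\<in>east_conf L. \<exists>B\<in>east_conf L. real (card A) \<noteq> real (card B)"
    by (intro bexI[of _ "{}"] bexI[of _ "{1}"]) auto
  hence "east_dirichlet q L (\<lambda>A. real (card A)) / east_var q L (\<lambda>A. real (card A))
    \<in> {east_dirichlet q L f / east_var q L f | f. \<exists>A\<in>east_conf L. \<exists>B\<in>east_conf L. f A \<noteq> f B}"
    by (intro CollectI exI[of _ "\<lambda>A. real (card A)"] conjI) (rule refl)
  thus "{east_dirichlet q L f / east_var q L f | f.
      \<exists>A\<in>east_conf L. \<exists>B\<in>east_conf L. f A \<noteq> f B} \<noteq> {}"
    by (rule ex_in_conv[THEN iffD1, OF exI])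
next
  fix r assume "r \<in> {east_dirichlet q L f / east_var q L f | f.
      \<exists>A\<in>east_conf L. \<exists>B\<in>east_conf L. f A \<noteq> f B}"
  then obtain f A B where r: "r = east_dirichlet q L f / east_var q L f"
    and "A \<in> east_conf L" "B \<in> east_conf L" "f A \<noteq> f B"
    by auto
  hence "0 < east_var q L f" by (intro east_var_pos)
  moreover have "east_var q L f \<le> K * east_dirichlet q L f"
    unfolding east_var_eq_var east_dirichlet_eq using assms by (intro poincareD[OF assms(1)]) auto
  ultimately show "1 / K \<le> r" unfolding r using assms(2) by (simp add: field_simps)
qed

lemma east_gap_le:
  assumes "0 < var q {0<..L} f {}"
  shows "east_gap q L \<le> dirichlet q 0 L f {} / var q {0<..L} f {}"
proof -
  have ne: "\<exists>A\<in>east_conf L. \<exists>B\<in>east_conf L. f A \<noteq> f B"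
  proof (rule ccontr)
    assume nonex: "\<not> ?thesis"
    have const: "f A = f {}" if "A \<in> east_conf L" for A
    proof (rule ccontr)
      assume "f A \<noteq> f {}"
      moreover have "{} \<in> east_conf L" by (simp add: east_conf_def)
      ultimately have "\<exists>A\<in>east_conf L. \<exists>B\<in>east_conf L. f A \<noteq> f B"
        using that by (intro bexI[of _ A] bexI[of _ "{}"])
      thus False using nonex by contradiction
    qed
    have "avg q {0<..L} (\<lambda>B. (f B - f {})\<^sup>2) {} = 0"
      unfolding avg_def
    proof (intro sum.neutral ballI)
      fix B assume "B \<in> Pow {0<..L}"
      hence "B \<in> east_conf L" by (auto simp: east_conf_def)
      from const[OF this]
      show "(1 - q) ^ card B * q ^ card ({0<..L} - B) * (f ({} - {0<..L} \<union> B) - f {})\<^sup>2 = 0" by simp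
    qed
    moreover have "var q {0<..L} f {} \<le> avg q {0<..L} (\<lambda>B. (f B - f {})\<^sup>2) {}"
      by (rule var_le_avg_square_sub) simp
    ultimately show False using assms by linarith
  qed
  have mem: "dirichlet q 0 L f {} / var q {0<..L} f {} \<in> {east_dirichlet q L f / east_var q L f | f.
      \<exists>A\<in>east_conf L. \<exists>B\<in>east_conf L. f A \<noteq> f B}"
    unfolding east_dirichlet_eq east_var_eq_var by (intro CollectI exI[of _ f] conjI ne) (rule refl)
  have "bdd_below {east_dirichlet q L f / east_var q L f | f.
      \<exists>A\<in>east_conf L. \<exists>B\<in>east_conf L. f A \<noteq> f B}"
  proof (rule bdd_belowI[of _ 0])
    fix r assume "r \<in> {east_dirichlet q L f / east_var q L f | f.
      \<exists>A\<in>east_conf L. \<exists>B\<in>east_conf L. f A \<noteq> f B}"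
    then obtain g where "r = east_dirichlet q L g / east_var q L g" by (elim CollectE exE conjE)
    thus "0 \<le> r"
      by (simp only: east_dirichlet_eq east_var_eq_var divide_nonneg_nonneg dirichlet_nonneg var_nonneg finite_greaterThanAtMost)
  qed
  thus ?thesis
    unfolding east_gap_def by (rule cInf_lower[OF mem])
qed

end

section \<open>The bottleneck\<close>

definition stage :: "nat \<Rightarrow> nat set \<Rightarrow> nat set" where
  "stage g Z = {z \<in> Z. z = 0 \<or> \<not> (g \<le> z \<and> z - g \<in> Z)}"

fun collapse :: "nat \<Rightarrow> nat set \<Rightarrow> nat set" where
  "collapse 0 Z = Z"
| "collapse (Suc g) Z = stage (Suc g) (collapse g Z)"

lemma collapse_subset: "collapse g Z \<subseteq> Z"
  by (induction g) (auto simp: stage_def)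

text \<open>Earlier stages leave distances of at least \<open>Suc g\<close>, and a pair at exactly
  that distance loses its right member.\<close>

lemma collapse_gap: "y \<in> collapse g Z \<Longrightarrow> z \<in> collapse g Z \<Longrightarrow> y < z \<Longrightarrow> g < z - y"
proof (induction g)
  case (Suc g)
  hence yz: "y \<in> collapse g Z" "z \<in> collapse g Z" by (auto simp: stage_def)
  hence "g < z - y" using Suc by blast
  moreover have "z - y \<noteq> Suc g"
  proof
    assume "z - y = Suc g"
    hence "z - Suc g = y" "Suc g \<le> z" by auto
    thus False using Suc.prems yz by (auto simp: stage_def)
  qed
  ultimately show ?case by simp
qed simp


section \<open>Intervals grown by jumps onto zeros\<close>

inductive chain :: "nat set \<Rightarrow> nat \<Rightarrow> nat \<Rightarrow> nat \<Rightarrow> bool" for Z x where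
  start: "chain Z x (x - 1) x"
| right: "chain Z x c b \<Longrightarrow> z \<in> Z \<Longrightarrow> b < z \<Longrightarrow> z - b \<le> b - c \<Longrightarrow> chain Z x c z"
| left: "chain Z x c b \<Longrightarrow> z \<in> Z \<Longrightarrow> z < c \<Longrightarrow> c - z \<le> b - c \<Longrightarrow> chain Z x z b"

lemma chain_bounds: "chain Z x c b \<Longrightarrow> 1 \<le> x \<Longrightarrow> c < x \<and> x \<le> b \<and> (b = x \<or> b \<in> Z)"
  by (induction rule: chain.induct) auto

text \<open>The growth only ever uses zeros inside the final interval. Hence the event is
  independent of every site outside it, in particular of the next zero to be reached.\<close>

lemma chain_local:
  assumes "chain Z x c b" "1 \<le> x" "\<And>z. c \<le> z \<Longrightarrow> z \<le> b \<Longrightarrow> z \<in> Z \<Longrightarrow> z \<in> Z'"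
  shows "chain Z' x c b"
  using assms
proof (induction rule: chain.induct)
  case start
  show ?case by (rule chain.start)
next
  case (right c b z)
  have cb: "c < b" using chain_bounds[OF right.hyps(1) right.prems(1)] by linarith
  have "chain Z' x c b"
  proof (rule right.IH[OF right.prems(1)])
    fix y assume "c \<le> y" "y \<le> b" "y \<in> Z"
    thus "y \<in> Z'" using right.hyps(3) by (intro right.prems(2)) auto
  qed
  moreover have "z \<in> Z'" using right.hyps cb by (intro right.prems(2)) auto
  ultimately show ?case using right.hyps(3,4) by (rule chain.right)
next
  case (left c b z)
  have cb: "c < b" using chain_bounds[OF left.hyps(1) left.prems(1)] by linarith
  have "chain Z' x c b"
  proof (rule left.IH[OF left.prems(1)])
    fix y assume "c \<le> y" "y \<le> b" "y \<in> Z"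
    thus "y \<in> Z'" using left.hyps(3) by (intro left.prems(2)) auto
  qed
  moreover have "z \<in> Z'" using left.hyps cb by (intro left.prems(2)) auto
  ultimately show ?case using left.hyps(3,4) by (rule chain.left)
qed

lemma chain_last_step:
  assumes "chain Z x c b" "1 \<le> x" "b - c \<noteq> 1"
  shows "(\<exists>b'. c < b' \<and> b' < b \<and> b - b' \<le> b' - c \<and> b \<in> Z \<and> chain Z x c b') \<or>
         (\<exists>c'. c < c' \<and> c' < b \<and> c' - c \<le> b - c' \<and> c \<in> Z \<and> chain Z x c' b)"
  using assms(1)
proof cases
  case start
  thus ?thesis using assms by auto
next
  case (right b')
  thus ?thesis using chain_bounds[OF right(1)] assms by auto
next
  case (left c')
  thus ?thesis using chain_bounds[OF left(1)] assms by auto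
qed

text \<open>If \<open>c\<close> is deleted at stage \<open>G\<close>, then \<open>c - G\<close> is a
  zero, and a jump of length \<open>G \<le> b - c\<close> onto it is allowed. Repeating this moves
  left until a survivor is met.\<close>

lemma chain_extend_left:
  assumes "chain Z x c b" "c \<in> U" "U \<subseteq> Z" "0 < G" "G \<le> b - c"
  shows "\<exists>c'\<le>c. c' \<in> stage G U \<and> chain Z x c' b"
  using assms
proof (induction c rule: less_induct)
  case (less c)
  show ?case
  proof (cases "c \<in> stage G U")
    case False
    hence c: "G \<le> c" "c - G \<in> U" "c \<noteq> 0" using less.prems by (auto simp: stage_def)
    have "chain Z x (c - G) b"
      using less.prems c by (intro chain.left[OF less.prems(1)]) auto
    moreover have "c - G < c" "G \<le> b - (c - G)" using less.prems c by linarith+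
    ultimately obtain c' where "c' \<le> c - G" "c' \<in> stage G U" "chain Z x c' b"
      using less.IH[of "c - G"] less.prems(3,4) c(2) by blast
    thus ?thesis by (intro exI[of _ c']) auto
  qed (use less in auto)
qed

text \<open>The two collapses can only differ inside a chain interval longer than the current stage: a
  discrepancy spreads by at most the stage number, and it is erased once the interval has exactly
  that length.\<close>

lemma collapse_discrepancy:
  assumes x: "1 \<le> x" "x - 1 \<in> Z"
  shows "collapse g Z = collapse g (insert x Z) \<or>
    (\<exists>c b. chain Z x c b \<and> c \<in> collapse g Z \<and> c \<in> collapse g (insert x Z) \<and> g < b - c \<and>
      (\<forall>z. z \<le> c \<or> b < z \<longrightarrow> (z \<in> collapse g Z \<longleftrightarrow> z \<in> collapse g (insert x Z))))"
proof (induction g)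
  case 0
  have "chain Z x (x - 1) x" by (rule chain.start)
  thus ?case using x by (intro disjI2 exI[of _ "x - 1"] exI[of _ x]) auto
next
  case (Suc g)
  define U U' where "U = collapse g Z" and "U' = collapse g (insert x Z)"
  define G where "G = Suc g"
  have collapse_G: "collapse G Z = stage G U" "collapse G (insert x Z) = stage G U'"
    by (simp_all add: G_def U_def U'_def)
  have gap: "G \<le> z - y" if "y \<in> U \<and> z \<in> U \<or> y \<in> U' \<and> z \<in> U'" "y < z" for y z
    using that collapse_gap[of y g _ z] by (auto simp: U_def U'_def G_def Suc_le_eq)
  have UZ: "U \<subseteq> Z" unfolding U_def by (rule collapse_subset)
  show ?case
  proof (cases "U = U'")
    case True
    hence "collapse G Z = collapse G (insert x Z)" by (simp add: collapse_G)
    thus ?thesis unfolding G_def by (rule disjI1)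
  next
    case False
    then obtain c b where ch: "chain Z x c b" and c: "c \<in> U" "c \<in> U'" "G \<le> b - c"
      and agree: "\<And>z. z \<le> c \<or> b < z \<Longrightarrow> z \<in> U \<longleftrightarrow> z \<in> U'"
      using Suc unfolding U_def U'_def G_def Suc_le_eq by blast
    \<comment> \<open>Survival of \<open>z\<close> depends on \<open>z\<close> and
      \<open>z - G\<close> only, so no discrepancy moves to the left of \<open>c\<close>.\<close>
    have low: "z \<in> stage G U \<longleftrightarrow> z \<in> stage G U'" if "z \<le> c" for z
    proof -
      have "z - G \<le> c" using that by simp
      from agree[OF disjI1[OF that]] agree[OF disjI1[OF this]] show ?thesis by (simp add: stage_def)
    qed
    obtain c' where c': "c' \<le> c" "c' \<in> stage G U" "chain Z x c' b"
      using chain_extend_left[OF ch c(1) UZ _ c(3)] by (auto simp: G_def)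
    \<comment> \<open>By \<open>gap\<close>, at most one zero of \<open>U\<close> lies in
      \<open>(b, b + G]\<close>. If there is one, the chain jumps onto it; beyond \<open>b'\<close>
      every zero of \<open>U\<close> then has its stage partner to the right of \<open>b\<close>,
      where \<open>U\<close> and \<open>U'\<close> agree.\<close>
    have "\<exists>b'\<ge>b. chain Z x c' b' \<and> (\<forall>z\<in>U. b' < z \<longrightarrow> b + G < z)"
    proof (cases "\<exists>z\<in>U. b < z \<and> z \<le> b + G")
      case True
      then obtain z where z: "z \<in> U" "b < z" "z \<le> b + G" by blast
      have "chain Z x c' z"
        using z c c'(1) UZ by (intro chain.right[OF c'(3)]) auto
      moreover have "b + G < y" if "y \<in> U" "z < y" for y
        using gap[of z y] z that by auto
      ultimately show ?thesis using z by (intro exI[of _ z]) auto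
    next
      case False
      thus ?thesis using c'(3) by (intro exI[of _ b]) force
    qed
    then obtain b' where b': "b \<le> b'" "chain Z x c' b'" "\<And>z. z \<in> U \<Longrightarrow> b' < z \<Longrightarrow> b + G < z"
      by blast
    have high: "z \<in> stage G U \<longleftrightarrow> z \<in> stage G U'" if "b' < z" for z
    proof (cases "z \<in> U")
      case True
      hence "b < z - G" using b'(3) that by fastforce
      moreover have "b < z" using that b'(1) by simp
      ultimately show ?thesis using agree[of z] agree[of "z - G"] by (simp add: stage_def)
    next
      case False
      thus ?thesis using agree[of z] that b'(1) by (auto simp: stage_def)
    qed
    show ?thesis
    proof (cases "G < b' - c'")
      case True
      thus ?thesis
        unfolding G_def[symmetric] collapse_G
        using b' c' low high by (intro disjI2 exI[of _ c'] exI[of _ b']) auto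
    next
      case False
      \<comment> \<open>The interval has length exactly \<open>G\<close>: any zero in
        \<open>(c, b]\<close> must sit at \<open>c + G\<close>, and \<open>c\<close> deletes it in
        both collapses.\<close>
      hence eq: "b' = b" "c' = c" "b = c + G" "0 < G" using b'(1) c'(1) c(3) by (auto simp: G_def)
      have "z \<notin> stage G V" if "V = U \<or> V = U'" "c < z" "z \<le> b" for z V
      proof
        assume z: "z \<in> stage G V"
        hence "z \<in> V" "c \<in> V" using that(1) c by (auto simp: stage_def)
        hence "G \<le> z - c" using gap[of c z] that by auto
        hence "z = c + G" using that eq by simp
        thus False using z \<open>c \<in> V\<close> eq(4) by (auto simp: stage_def)
      qed
      hence "z \<in> stage G U \<longleftrightarrow> z \<in> stage G U'" for z
        using low[of z] high[of z] eq by (cases "z \<le> c"; cases "z \<le> b") auto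
      hence "stage G U = stage G U'" by blast
      thus ?thesis unfolding G_def[symmetric] collapse_G by blast
    qed
  qed
qed

text \<open>A discrepancy after stage \<open>M - 1\<close> yields a chain interval of length at
  least \<open>M\<close>; its right end is \<open>x\<close> or a zero, hence at most
  \<open>M\<close>, so the interval is all of \<open>[0, M]\<close>.\<close>

lemma collapse_flip_chain:
  assumes "1 \<le> x" "x \<le> M" "x - 1 \<in> Z" "Z \<subseteq> {0..M}"
    and "M \<in> collapse (M - 1) Z \<longleftrightarrow> M \<notin> collapse (M - 1) (insert x Z)"
  shows "chain Z x 0 M"
proof -
  have "collapse (M - 1) Z \<noteq> collapse (M - 1) (insert x Z)" using assms(5) by auto
  then obtain c b where cb: "chain Z x c b" "M - 1 < b - c"
    using collapse_discrepancy[OF assms(1,3)] by blast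
  have "b \<le> M" using chain_bounds[OF cb(1) assms(1)] assms(2,4) by auto
  hence "c = 0" "b = M" using cb(2) assms(1,2) by auto
  thus ?thesis using cb(1) by simp
qed

section \<open>The test function and its Dirichlet form\<close>

lemma collapse_trivial:
  assumes "g < M"
  shows "collapse g {0, M} = {0, M}"
  using assms
proof (induction g)
  case (Suc g)
  hence "collapse g {0, M} = {0, M}" by simp
  moreover have "M - Suc g \<noteq> 0" "M - Suc g \<noteq> M" using Suc.prems by auto
  ultimately show ?case by (auto simp: stage_def)
qed simp

text \<open>Site 0 is added as a frozen zero, matching the absence of a constraint at site
  1.\<close>

definition zeros :: "nat \<Rightarrow> nat set \<Rightarrow> nat set" where
  "zeros M A = {z. z \<le> M \<and> (z = 0 \<or> z \<notin> A)}"

definition blocked :: "nat \<Rightarrow> nat set \<Rightarrow> real" where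
  "blocked M A = of_bool (M \<in> collapse (M - 1) (zeros M A))"

context bernoulli
begin

lemma avg_zero_indep:
  assumes "finite S" "y \<in> S" "invariant_on {y} g"
  shows "avg q S (\<lambda>A. of_bool (y \<notin> A) * g A) A = q * avg q S g A"
proof -
  have S: "avg q S h A = avg q (S - {y}) (avg q {y} h) A" for h
  proof -
    have "(S - {y}) \<union> {y} = S" using assms by auto
    thus ?thesis using avg_union[of "S - {y}" "{y}" q h A] assms by simp
  qed
  have g: "g (insert y B) = g B" "g (B - {y}) = g B" for B
    by (rule invariant_onD[OF assms(3)]; auto)+
  have "avg q {y} (\<lambda>A. of_bool (y \<notin> A) * g A) = (\<lambda>B. q * g B)"
    by (rule ext) (simp add: avg_singleton g)
  moreover have "avg q {y} g = g" by (rule ext) (simp add: avg_singleton g algebra_simps)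
  ultimately show ?thesis by (simp add: S avg_cmult)
qed

lemma invariant_on_chain:
  assumes "1 \<le> x" "y < c \<or> b < y"
  shows "invariant_on {y} (\<lambda>A. of_bool (chain (zeros M A) x c b) :: real)"
proof -
  have "chain (zeros M B) x c b" if "A - {y} = B - {y}" "chain (zeros M A) x c b" for A B
  proof (rule chain_local[OF that(2) assms(1)])
    fix z assume z: "c \<le> z" "z \<le> b" "z \<in> zeros M A"
    hence "z \<in> A - {y} \<longleftrightarrow> z \<in> A" "z \<in> B - {y} \<longleftrightarrow> z \<in> B" using assms(2) by auto
    thus "z \<in> zeros M B" using z that(1) by (auto simp: zeros_def)
  qed
  from this this[OF sym] show ?thesis
    unfolding invariant_on_def by (intro allI impI arg_cong[where f = of_bool] iffI)
qed

lemma chain_prob_le: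
  assumes "1 \<le> x" "M \<le> L" and W0: "\<And>D. 0 \<le> W D" and W1: "1 \<le> W 1"
    and Wrec: "\<And>D. 2 \<le> D \<Longrightarrow> D \<le> M \<Longrightarrow> 2 * q * (\<Sum>D'\<in>{D'. D' < D \<and> D \<le> 2 * D'}. W D') \<le> W D"
  shows "c < b \<Longrightarrow> b \<le> M \<Longrightarrow>
    avg q {0<..L} (\<lambda>A. of_bool (chain (zeros M A) x c b)) A \<le> W (b - c) * (if c = 0 then 1 / q else 1)"
proof (induction "b - c" arbitrary: c b rule: less_induct)
  case less
  let ?P = "\<lambda>c b. avg q {0<..L} (\<lambda>A. of_bool (chain (zeros M A) x c b)) A"
  let ?k = "if c = 0 then 1 / q else 1"
  define D where "D = b - c"
  \<comment> \<open>A jump at most doubles the length, so \<open>R\<close> contains every possible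
    previous length. Below, \<open>?r\<close> and \<open>?l\<close> are the last jumps to the right
    onto \<open>b\<close> and to the left onto \<open>c\<close>.\<close>
  define R where "R = {D'. D' < D \<and> D \<le> 2 * D'}"
  have k1: "1 \<le> ?k" using q_pos q_half by simp
  show ?case
  proof (cases "D = 1")
    case True
    have "?P c b \<le> avg q {0<..L} (\<lambda>_. 1) A" by (rule avg_mono) simp
    also have "\<dots> = 1" by (simp add: avg_const)
    also have "1 \<le> W 1 * ?k" using mult_mono[OF W1 k1] W0[of 1] by simp
    finally show ?thesis using True by (simp add: D_def)
  next
    case False
    hence D2: "2 \<le> D" using less.prems by (simp add: D_def)
    have fin: "finite R" by (rule finite_subset[of _ "{..D}"]) (auto simp: R_def)
    let ?r = "\<lambda>D' A. of_bool (b \<notin> A) * of_bool (chain (zeros M A) x c (c + D')) :: real"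
    let ?l = "\<lambda>D' A. of_bool (c \<in> zeros M A) * of_bool (chain (zeros M A) x (b - D') b) :: real"
    have "of_bool (chain (zeros M A) x c b) \<le> (\<Sum>D'\<in>R. ?r D' A) + (\<Sum>D'\<in>R. ?l D' A)" for A
    proof (cases "chain (zeros M A) x c b")
      case True
      have nn: "0 \<le> (\<Sum>D'\<in>R. ?r D' A)" "0 \<le> (\<Sum>D'\<in>R. ?l D' A)" by (auto intro!: sum_nonneg)
      have "b - c \<noteq> 1" using False by (simp add: D_def)
      from chain_last_step[OF True assms(1) this] show ?thesis
      proof (elim disjE exE conjE)
        fix b' assume b': "c < b'" "b' < b" "b - b' \<le> b' - c" "b \<in> zeros M A" "chain (zeros M A) x c b'"
        hence R: "b' - c \<in> R" by (auto simp: R_def D_def)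
        have "1 = ?r (b' - c) A" using b' less.prems by (auto simp: zeros_def)
        also have "\<dots> \<le> (\<Sum>D'\<in>R. ?r D' A)" by (rule member_le_sum[OF R _ fin]) simp
        finally show ?thesis using True nn by simp
      next
        fix c' assume c': "c < c'" "c' < b" "c' - c \<le> b - c'" "c \<in> zeros M A" "chain (zeros M A) x c' b"
        hence R: "b - c' \<in> R" by (auto simp: R_def D_def)
        have "1 = ?l (b - c') A" using c' by simp
        also have "\<dots> \<le> (\<Sum>D'\<in>R. ?l D' A)" by (rule member_le_sum[OF R _ fin]) simp
        finally show ?thesis using True nn by simp
      qed
    next
      case False
      thus ?thesis by (auto intro!: add_nonneg_nonneg sum_nonneg)
    qed
    hence "?P c b \<le> avg q {0<..L} (\<lambda>A. (\<Sum>D'\<in>R. ?r D' A) + (\<Sum>D'\<in>R. ?l D' A)) A"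
      by (rule avg_mono)
    also have "\<dots> = (\<Sum>D'\<in>R. avg q {0<..L} (?r D') A) + (\<Sum>D'\<in>R. avg q {0<..L} (?l D') A)"
      by (simp only: avg_add avg_sum)
    also have "\<dots> \<le> (\<Sum>D'\<in>R. q * W D' * ?k) + (\<Sum>D'\<in>R. q * W D' * ?k)"
    proof (intro add_mono sum_mono)
      fix D' assume D': "D' \<in> R"
      hence bd: "0 < D'" "D' < D" "c + D' < b" using D2 less.prems by (auto simp: R_def D_def)
      have "avg q {0<..L} (?r D') A = q * ?P c (c + D')"
        using less.prems assms(1,2) bd by (intro avg_zero_indep invariant_on_chain) auto
      also have "\<dots> \<le> q * (W D' * ?k)"
        using less.hyps[of "c + D'" c] bd less.prems q_pos by (intro mult_left_mono) (auto simp: D_def)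
      finally show "avg q {0<..L} (?r D') A \<le> q * W D' * ?k" by (simp add: mult_ac)
      have IH: "?P (b - D') b \<le> W D'"
        using less.hyps[of b "b - D'"] bd less.prems by (auto simp: D_def)
      show "avg q {0<..L} (?l D') A \<le> q * W D' * ?k"
      proof (cases "c = 0")
        \<comment> \<open>Before a jump onto 0 the left end is positive, so the induction hypothesis
          has no factor \<open>1 / q\<close> yet; that factor now replaces the missing
          \<open>q\<close>.\<close>
        case True
        hence "avg q {0<..L} (?l D') A = ?P (b - D') b" by (simp add: zeros_def)
        thus ?thesis using IH True q_pos by simp
      next
        case False
        have "?l D' = (\<lambda>A. of_bool (c \<notin> A) * of_bool (chain (zeros M A) x (b - D') b))"
          using False less.prems by (auto simp: zeros_def)
        hence "avg q {0<..L} (?l D') A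
            = avg q {0<..L} (\<lambda>A. of_bool (c \<notin> A) * of_bool (chain (zeros M A) x (b - D') b)) A"
          by (rule arg_cong)
        also have "\<dots> = q * ?P (b - D') b"
          using less.prems assms(1,2) bd False by (intro avg_zero_indep invariant_on_chain) auto
        also have "\<dots> \<le> q * W D'" using IH q_pos by (intro mult_left_mono) auto
        finally show ?thesis using False by simp
      qed
    qed
    also have "\<dots> = 2 * q * (\<Sum>D'\<in>R. W D') * ?k"
      by (simp only: sum_distrib_left sum_distrib_right flip: sum.distrib) (simp add: algebra_simps)
    also have "\<dots> \<le> W D * ?k"
      using Wrec[of D] D2 less.prems k1 unfolding R_def by (intro mult_right_mono) (auto simp: D_def)
    finally show ?thesis by (simp add: D_def)
  qed
qed

lemma blocked_local:
  assumes "\<And>z. 0 < z \<Longrightarrow> z \<le> M \<Longrightarrow> z \<in> A \<longleftrightarrow> z \<in> B"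
  shows "blocked M A = blocked M B"
proof -
  have "zeros M A = zeros M B" using assms by (auto simp: zeros_def)
  thus ?thesis by (simp add: blocked_def)
qed

text \<open>The left-hand side is nonzero only if the flip at \<open>x\<close> is legal and changes
  the indicator, which forces a chain over \<open>[0, M]\<close>; the variance of an indicator is at
  most 1.\<close>

lemma constraint_var_blocked_le:
  assumes "1 \<le> x" "x \<le> M"
  shows "constraint 0 x A * var q {x} (blocked M) A \<le> of_bool (chain (zeros M A) x 0 M)"
proof (cases "constraint 0 x A = 0 \<or> blocked M (insert x A) = blocked M (A - {x})")
  case True
  have "var q {x} (blocked M) A = 0" if "blocked M (insert x A) = blocked M (A - {x})"
    using that by (simp add: var_def avg_singleton algebra_simps power2_eq_square)
  thus ?thesis using True by auto
next
  case False
  let ?Z = "zeros M (insert x A)"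
  have c: "constraint 0 x A = 1" using False by (auto simp: constraint_def split: if_splits)
  have "zeros M (A - {x}) = insert x ?Z" using assms by (auto simp: zeros_def)
  hence "M \<in> collapse (M - 1) ?Z \<longleftrightarrow> M \<notin> collapse (M - 1) (insert x ?Z)"
    using False by (auto simp: blocked_def)
  moreover have "x - 1 \<in> ?Z" "?Z \<subseteq> {0..M}"
    using assms False by (auto simp: zeros_def constraint_def split: if_splits)
  ultimately have "chain ?Z x 0 M" using assms by (intro collapse_flip_chain)
  hence "chain (zeros M A) x 0 M"
    by (rule chain_local) (use assms in \<open>auto simp: zeros_def\<close>)
  moreover have "var q {x} (blocked M) A \<le> 1"
  proof -
    have "var q {x} (blocked M) A \<le> avg q {x} (\<lambda>B. (blocked M B - 0)\<^sup>2) A"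
      by (rule var_le_avg_square_sub) simp
    also have "\<dots> \<le> avg q {x} (\<lambda>_. 1) A" by (rule avg_mono) (simp add: blocked_def)
    finally show ?thesis by (simp add: avg_const)
  qed
  ultimately show ?thesis using c by simp
qed

lemma dirichlet_blocked_le:
  assumes "M \<le> L" "1 \<le> M" and W0: "\<And>D. 0 \<le> W D" and W1: "1 \<le> W 1"
    and Wrec: "\<And>D. 2 \<le> D \<Longrightarrow> D \<le> M \<Longrightarrow> 2 * q * (\<Sum>D'\<in>{D'. D' < D \<and> D \<le> 2 * D'}. W D') \<le> W D"
  shows "dirichlet q 0 L (blocked M) A \<le> real M * W M / q"
proof -
  let ?t = "\<lambda>x. avg q {0<..L} (\<lambda>B. constraint 0 x B * var q {x} (blocked M) B) A"
  have "?t x \<le> (if x \<le> M then W M / q else 0)" if "x \<in> {0<..L}" for x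
  proof (cases "x \<le> M")
    case True
    hence "?t x \<le> avg q {0<..L} (\<lambda>B. of_bool (chain (zeros M B) x 0 M)) A"
      using that by (intro avg_mono constraint_var_blocked_le) auto
    also have "\<dots> \<le> W M / q"
      using chain_prob_le[of x M L W 0 M A] assms that by simp
    finally show ?thesis using True by simp
  next
    case False
    have "blocked M (insert x B) = blocked M (B - {x})" for B
      using False by (intro blocked_local) auto
    hence "var q {x} (blocked M) B = 0" for B
      by (simp add: var_def avg_singleton algebra_simps power2_eq_square)
    thus ?thesis using False by (simp add: avg_const)
  qed
  hence "dirichlet q 0 L (blocked M) A \<le> (\<Sum>x\<in>{0<..L}. if x \<le> M then W M / q else 0)"
    unfolding dirichlet_def by (rule sum_mono)
  also have "\<dots> = (\<Sum>x\<in>{0<..M}. W M / q)"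
    using assms(1) by (intro sum.mono_neutral_cong_right) auto
  finally show ?thesis by simp
qed

lemma var_blocked_ge:
  assumes "M \<le> L" "1 \<le> M" "q * real M \<le> 1 / 2"
  shows "q / 4 \<le> var q {0<..L} (blocked M) A"
proof -
  let ?a = "avg q {0<..L} (blocked M) A"
  have "1 - real M * q \<le> (1 - q) ^ M"
    using Bernoulli_inequality[of "- q" M] q_half by simp
  hence pM: "1 / 2 \<le> (1 - q) ^ M" using assms(3) by (simp add: mult.commute)
  have "(1 - q) ^ M = avg q {0<..L} (\<lambda>B. if {0<..M} \<subseteq> B then 1 else 0) A"
    using assms by (subst avg_all_ones) auto
  also have "\<dots> \<le> avg q {0<..L} (\<lambda>B. 1 - blocked M B) A"
  proof (rule avg_mono)
    fix B
    have "zeros M B = {0}" if "{0<..M} \<subseteq> B" using that by (auto simp: zeros_def)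
    moreover have "M \<notin> collapse (M - 1) {0}" using collapse_subset[of "M - 1" "{0}"] assms(2) by auto
    ultimately show "(if {0<..M} \<subseteq> B then 1 else 0) \<le> 1 - blocked M B" by (auto simp: blocked_def)
  qed
  also have "\<dots> = 1 - ?a" by (simp add: avg_diff avg_const)
  finally have up: "(1 - q) ^ M \<le> 1 - ?a" .
  have inv: "invariant_on {M} (\<lambda>B. if {0<..<M} \<subseteq> B then 1 else 0 :: real)"
  proof -
    have "{0<..<M} \<subseteq> B \<longleftrightarrow> {0<..<M} \<subseteq> B - {M}" for B by auto
    thus ?thesis unfolding invariant_on_def by metis
  qed
  have "q * (1 - q) ^ (M - 1)
      = q * avg q {0<..L} (\<lambda>B. if {0<..<M} \<subseteq> B then 1 else 0) A"
    using assms by (subst avg_all_ones) auto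
  also have "\<dots> = avg q {0<..L} (\<lambda>B. of_bool (M \<notin> B) * (if {0<..<M} \<subseteq> B then 1 else 0)) A"
    using assms by (intro avg_zero_indep[symmetric] inv) auto
  also have "\<dots> \<le> ?a"
  proof (rule avg_mono)
    fix B
    have "zeros M B = {0, M}" if B: "{0<..<M} \<subseteq> B" "M \<notin> B"
    proof (rule set_eqI)
      fix z
      show "z \<in> zeros M B \<longleftrightarrow> z \<in> {0, M}"
        using B assms(2) by (cases "z = 0"; cases z M rule: linorder_cases) (auto simp: zeros_def)
    qed
    moreover have "M \<in> collapse (M - 1) {0, M}" using collapse_trivial[of "M - 1" M] assms(2) by simp
    ultimately show "of_bool (M \<notin> B) * (if {0<..<M} \<subseteq> B then 1 else 0) \<le> blocked M B"
      by (auto simp: blocked_def)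
  qed
  finally have "q * (1 - q) ^ (M - 1) \<le> ?a" .
  moreover have "(1 - q) ^ M \<le> (1 - q) ^ (M - 1)" using q_pos q_half by (intro power_decreasing) auto
  hence "q * (1 / 2) \<le> q * (1 - q) ^ (M - 1)" using pM q_pos by (intro mult_left_mono) auto
  ultimately have low: "q / 2 \<le> ?a" by simp
  have "(\<lambda>B. (blocked M B)\<^sup>2) = blocked M" by (auto simp: blocked_def)
  hence "var q {0<..L} (blocked M) A = ?a * (1 - ?a)"
    by (simp add: var_def power2_eq_square algebra_simps)
  also have "\<dots> \<ge> (q / 2) * (1 / 2)" using low up pM q_pos by (intro mult_mono) auto
  finally show ?thesis by simp
qed

end

section \<open>Weighted count of chains\<close>

text \<open>Comparison with the integral of \<open>t ^ (- Suc \<nu>)\<close>, done discretely: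
  Bernoulli's inequality bounds each term after the first by a difference that telescopes.\<close>

lemma sum_inverse_power_le:
  fixes a b \<nu> :: nat
  assumes "1 \<le> a" "1 \<le> \<nu>"
  shows "(\<Sum>t\<in>{a..<b}. (real a / real t) ^ Suc \<nu>) \<le> 1 + real a / real \<nu>"
proof (cases "a < b")
  case False
  thus ?thesis using assms by simp
next
  case True
  have "(\<Sum>t\<in>{a..<Suc b}. (real a / real t) ^ Suc \<nu>) \<le> 1 + real a / real \<nu> * (1 - (real a / real b) ^ \<nu>)"
    if "a \<le> b" for b
    using that
  proof (induction b rule: dec_induct)
    case base
    show ?case using assms by simp
  next
    case (step b)
    let ?s = "real (Suc b)"
    have b: "0 < real b" using step assms by simp
    have "1 + real \<nu> / ?s \<le> 1 + real \<nu> * (1 / real b)"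
      using b by (simp add: divide_left_mono)
    also have "\<dots> \<le> (1 + 1 / real b) ^ \<nu>"
      using b by (intro Bernoulli_inequality) (smt (verit) zero_le_divide_1_iff)
    also have "1 + 1 / real b = ?s / real b" using b by (simp add: field_simps)
    finally have 1: "real \<nu> / ?s \<le> (?s / real b) ^ \<nu> - 1" by simp
    have "(real a / ?s) ^ Suc \<nu> = (real a / real \<nu>) * (real a / ?s) ^ \<nu> * (real \<nu> / ?s)"
      using assms by simp
    also have "\<dots> \<le> (real a / real \<nu>) * (real a / ?s) ^ \<nu> * ((?s / real b) ^ \<nu> - 1)"
      using 1 by (intro mult_left_mono) auto
    also have "\<dots> = (real a / real \<nu>) * ((real a / ?s * (?s / real b)) ^ \<nu> - (real a / ?s) ^ \<nu>)"
      by (simp only: power_mult_distrib right_diff_distrib mult.assoc mult_1_right)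
    also have "real a / ?s * (?s / real b) = real a / real b" by simp
    finally have "(real a / ?s) ^ Suc \<nu>
        \<le> (real a / real \<nu>) * ((real a / real b) ^ \<nu> - (real a / ?s) ^ \<nu>)" .
    moreover have "(\<Sum>t\<in>{a..<Suc (Suc b)}. (real a / real t) ^ Suc \<nu>)
        = (\<Sum>t\<in>{a..<Suc b}. (real a / real t) ^ Suc \<nu>) + (real a / ?s) ^ Suc \<nu>"
      using step by simp
    ultimately show ?case using step.IH by (simp only: right_diff_distrib)
  qed
  from this[of "b - 1"] True
  have "(\<Sum>t\<in>{a..<b}. (real a / real t) ^ Suc \<nu>)
      \<le> 1 + real a / real \<nu> * (1 - (real a / real (b - 1)) ^ \<nu>)"
    by simp
  also have "\<dots> \<le> 1 + real a / real \<nu> * 1"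
    by (intro add_left_mono mult_left_mono) auto
  finally show ?thesis by simp
qed

context bernoulli
begin

text \<open>The value of the supersolution at length \<open>2 ^ k\<close>. In each factor, 4 is the
  2 of the recursion times 2 for using only half of the allowance, and the bracket is the bound of
  \<open>sum_inverse_power_le\<close> with \<open>\<nu> = m - j + 1\<close>.\<close>

definition amp :: "nat \<Rightarrow> nat \<Rightarrow> real" where
  "amp m k = (\<Prod>j<k. 4 * q * (1 + 2 ^ Suc j / real (m - j + 1)))"

text \<open>A supersolution of the recursion in \<open>chain_prob_le\<close>. On the dyadic scale \<open>2 ^ k\<close> the decay
  exponent \<open>m - k + 2\<close> makes the chains lengthen almost exactly by doubling, which
  produces the factor \<open>1 / (m - k + 1)\<close> in \<open>amp\<close> and ultimately the factorial.\<close>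

definition weight :: "nat \<Rightarrow> nat \<Rightarrow> real" where
  "weight m D = amp m (floor_log D) * (2 ^ floor_log D / real D) ^ (m - floor_log D + 2)"

lemma amp_nonneg: "0 \<le> amp m k"
  unfolding amp_def using q_pos by (intro prod_nonneg) auto

lemma weight_nonneg: "0 \<le> weight m D"
  unfolding weight_def by (intro mult_nonneg_nonneg amp_nonneg) simp

lemma weight_power: "weight m (2 ^ k) = amp m k"
  by (simp add: weight_def)

text \<open>Predecessors on the dyadic scale below that of \<open>D\<close> use one half of
  \<open>weight m D\<close>, exactly by the choice of \<open>amp\<close>. Those on the same scale
  are counted crudely, and the smallness of \<open>q * 2 ^ m\<close> fits them into the other
  half.\<close>

lemma weight_recursion:
  assumes q: "q * 2 ^ (m + 4) \<le> 1" and D: "2 \<le> D" "D \<le> 2 ^ m"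
  shows "2 * q * (\<Sum>D'\<in>{D'. D' < D \<and> D \<le> 2 * D'}. weight m D') \<le> weight m D"
proof -
  have "floor_log 2 \<le> floor_log D" by (rule floor_log_le_iff[OF D(1)])
  moreover have "floor_log 2 = 1" using floor_log_power[of 1] by simp
  ultimately obtain k where k: "floor_log D = Suc k"
    by (metis One_nat_def Suc_le_D)
  have Dk: "2 ^ Suc k \<le> D" "D < 2 * 2 ^ Suc k"
    using floor_log_exp2_le[of D] floor_log_exp2_gt[of D] D k by auto
  have "(2::nat) ^ Suc k \<le> 2 ^ m" using Dk D by linarith
  hence km: "Suc k \<le> m" by (rule power_le_imp_le_exp[rotated]) simp
  \<comment> \<open>The least admissible predecessor, half of \<open>D\<close> rounded up.\<close>
  define a where "a = (D + 1) div 2"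
  have a: "2 ^ k \<le> a" "a \<le> 2 ^ Suc k" "D \<le> 2 * a" using Dk by (auto simp: a_def)
  hence a1: "1 \<le> a" by (metis one_le_numeral one_le_power order_trans)
  define \<nu> where "\<nu> = m - k + 1"
  have nu: "m - k + 2 = Suc \<nu>" "m - Suc k + 2 = \<nu>" "1 \<le> \<nu>" using km by (auto simp: \<nu>_def)
  define \<rho> where "\<rho> = 2 ^ Suc k / real D"
  have D0: "0 < real D" using D by simp
  have "real (2 ^ Suc k) \<le> real D" "real D \<le> real (2 * 2 ^ Suc k)"
    using Dk by (simp_all only: of_nat_le_iff less_imp_le)
  hence rho: "0 \<le> \<rho>" "\<rho> \<le> 1" "1 / 2 \<le> \<rho>" using D0 by (auto simp: \<rho>_def field_simps)
  have WD: "weight m D = amp m (Suc k) * \<rho> ^ \<nu>"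
    unfolding weight_def k nu \<rho>_def by (rule refl)
  have low: "weight m D' \<le> amp m k * \<rho> ^ \<nu> * (real a / real D') ^ Suc \<nu>"
    if "D' \<in> {a..<2 ^ Suc k}" for D'
  proof -
    have fl: "floor_log D' = k" using that a a1 by (intro floor_log_eqI) auto
    have D'0: "0 < real D'" using that a1 by simp
    \<comment> \<open>This separates the position of \<open>D\<close> in its scale from that of
      \<open>D'\<close>. The exponent is \<open>Suc \<nu>\<close> on scale \<open>k\<close> and
      \<open>\<nu>\<close> on the next one, so one power of \<open>\<rho> \<le> 1\<close> is given
      away.\<close>
    have "2 ^ k / real D' \<le> \<rho> * (real a / real D')"
    proof -
      have "real D \<le> 2 * real a" using a(3) by linarith
      hence "2 ^ k * real D \<le> 2 ^ k * (2 * real a)" by (intro mult_left_mono) auto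
      thus ?thesis using D0 D'0 by (simp add: \<rho>_def field_simps)
    qed
    hence "(2 ^ k / real D') ^ Suc \<nu> \<le> (\<rho> * (real a / real D')) ^ Suc \<nu>"
      by (intro power_mono) auto
    also have "\<dots> = \<rho> ^ Suc \<nu> * (real a / real D') ^ Suc \<nu>" by (rule power_mult_distrib)
    also have "\<dots> \<le> \<rho> ^ \<nu> * (real a / real D') ^ Suc \<nu>"
      using rho by (intro mult_right_mono power_decreasing) auto
    finally have "amp m k * (2 ^ k / real D') ^ Suc \<nu> \<le> amp m k * (\<rho> ^ \<nu> * (real a / real D') ^ Suc \<nu>)"
      by (rule mult_left_mono[OF _ amp_nonneg])
    thus ?thesis unfolding weight_def fl nu by (simp only: mult.assoc)
  qed
  have high: "weight m D' \<le> amp m (Suc k)" if "D' \<in> {2 ^ Suc k..<D}" for D'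
  proof -
    have "1 \<le> (2::nat) ^ Suc k" by simp
    hence D'0: "0 < D'" using that by (simp only: atLeastLessThan_iff) linarith
    hence fl: "floor_log D' = Suc k" using that Dk by (intro floor_log_eqI) auto
    have "real (2 ^ Suc k) \<le> real D'" using that by (simp only: of_nat_le_iff) simp
    with D'0 have "(2 ^ Suc k / real D') ^ (m - Suc k + 2) \<le> 1"
      by (intro power_le_one) auto
    from mult_left_mono[OF this amp_nonneg] show ?thesis
      unfolding weight_def fl by (simp only: mult_1_right)
  qed
  have "(\<Sum>D'\<in>{D'. D' < D \<and> D \<le> 2 * D'}. weight m D')
      \<le> (\<Sum>D'\<in>{a..<2 ^ Suc k} \<union> {2 ^ Suc k..<D}. weight m D')"
    by (intro sum_mono2 weight_nonneg) (auto simp: a_def)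
  also have "\<dots> = (\<Sum>D'\<in>{a..<2 ^ Suc k}. weight m D') + (\<Sum>D'\<in>{2 ^ Suc k..<D}. weight m D')"
    by (intro sum.union_disjoint) auto
  finally have split: "(\<Sum>D'\<in>{D'. D' < D \<and> D \<le> 2 * D'}. weight m D')
      \<le> (\<Sum>D'\<in>{a..<2 ^ Suc k}. weight m D') + (\<Sum>D'\<in>{2 ^ Suc k..<D}. weight m D')" .
  have "(\<Sum>D'\<in>{a..<2 ^ Suc k}. weight m D')
      \<le> amp m k * \<rho> ^ \<nu> * (\<Sum>D'\<in>{a..<2 ^ Suc k}. (real a / real D') ^ Suc \<nu>)"
    unfolding sum_distrib_left by (rule sum_mono) (rule low)
  also have "\<dots> \<le> amp m k * \<rho> ^ \<nu> * (1 + real a / real \<nu>)"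
    using rho by (intro mult_left_mono sum_inverse_power_le a1 nu mult_nonneg_nonneg amp_nonneg) auto
  also have "\<dots> \<le> amp m k * \<rho> ^ \<nu> * (1 + 2 ^ Suc k / real \<nu>)"
  proof -
    have "real a \<le> real (2 ^ Suc k)" using a(2) by (simp only: of_nat_le_iff)
    thus ?thesis
      using rho by (intro mult_left_mono add_left_mono divide_right_mono mult_nonneg_nonneg amp_nonneg) auto
  qed
  finally have "2 * q * (\<Sum>D'\<in>{a..<2 ^ Suc k}. weight m D')
      \<le> 2 * q * (amp m k * \<rho> ^ \<nu> * (1 + 2 ^ Suc k / real \<nu>))"
    using q_pos by (intro mult_left_mono) auto
  also have "\<dots> = weight m D / 2"
    unfolding WD by (simp add: amp_def \<nu>_def)
  finally have first: "2 * q * (\<Sum>D'\<in>{a..<2 ^ Suc k}. weight m D') \<le> weight m D / 2" .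
  have "(\<Sum>D'\<in>{2 ^ Suc k..<D}. weight m D') \<le> (\<Sum>D'\<in>{2 ^ Suc k..<D}. amp m (Suc k))"
    by (rule sum_mono) (rule high)
  also have "\<dots> = real (D - 2 ^ Suc k) * amp m (Suc k)" by simp
  also have "\<dots> \<le> real (2 ^ Suc k) * amp m (Suc k)"
  proof (rule mult_right_mono[OF _ amp_nonneg])
    have "D - 2 ^ Suc k \<le> 2 ^ Suc k" using Dk(2) by linarith
    thus "real (D - 2 ^ Suc k) \<le> real (2 ^ Suc k)" by (simp only: of_nat_le_iff)
  qed
  finally have "2 * q * (\<Sum>D'\<in>{2 ^ Suc k..<D}. weight m D') \<le> 2 * q * (2 ^ Suc k * amp m (Suc k))"
    using q_pos by (intro mult_left_mono) auto
  also have "\<dots> = amp m (Suc k) * (q * 2 ^ (k + 2))" by simp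
  also have "\<dots> \<le> amp m (Suc k) * (\<rho> ^ \<nu> / 2)"
  proof (rule mult_left_mono[OF _ amp_nonneg])
    \<comment> \<open>The worst case is \<open>\<rho> = 1 / 2\<close>, where the decay costs
      \<open>2 ^ \<nu>\<close>; this fixes the constant 4 in the hypothesis on
      \<open>q\<close>.\<close>
    have "m + 4 = (k + 2) + (\<nu> + 1)" using km by (simp add: \<nu>_def)
    hence "(2::real) ^ (m + 4) = 2 ^ (k + 2) * 2 ^ (\<nu> + 1)" by (simp only: power_add)
    hence "q * 2 ^ (k + 2) * 2 ^ (\<nu> + 1) \<le> 1" using q by (simp only: mult.assoc)
    hence "q * 2 ^ (k + 2) \<le> (1 / 2) ^ \<nu> / 2" by (simp add: field_simps)
    also have "(1 / 2) ^ \<nu> / 2 \<le> \<rho> ^ \<nu> / 2"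
      using rho by (intro divide_right_mono power_mono) auto
    finally show "q * 2 ^ (k + 2) \<le> \<rho> ^ \<nu> / 2" .
  qed
  also have "\<dots> = weight m D / 2" by (simp add: WD)
  finally have second: "2 * q * (\<Sum>D'\<in>{2 ^ Suc k..<D}. weight m D') \<le> weight m D / 2" .
  have "2 * q * (\<Sum>D'\<in>{D'. D' < D \<and> D \<le> 2 * D'}. weight m D')
      \<le> 2 * q * ((\<Sum>D'\<in>{a..<2 ^ Suc k}. weight m D') + (\<Sum>D'\<in>{2 ^ Suc k..<D}. weight m D'))"
    using split q_pos by (intro mult_left_mono) auto
  also have "\<dots> \<le> weight m D" using first second by (simp only: distrib_left)
  finally show ?thesis .
qed

text \<open>With \<open>r = m - j + 1\<close>, each bracket is at most \<open>2 ^ Suc j / r\<close>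
  times \<open>exp (r / 2 ^ Suc j)\<close>. The \<open>1 / r\<close> multiply to the ratio of
  factorials, and bounding \<open>r\<close> by \<open>m + 1\<close> makes the exponents a geometric
  series.\<close>

lemma amp_le:
  assumes "k \<le> m"
  shows "amp m k \<le> (8 * q) ^ k * 2 ^ (k choose 2) * exp (real (m + 1) * (1 - 1 / 2 ^ k))
    * (fact (m + 1 - k) / fact (m + 1))"
  using assms
proof (induction k)
  case 0
  show ?case by (simp add: amp_def numeral_2_eq_2)
next
  case (Suc k)
  define r where "r = real (m - k + 1)"
  have r: "0 < r" "r \<le> real (m + 1)" by (auto simp: r_def)
  let ?e = "\<lambda>k. exp (real (m + 1) * (1 - 1 / 2 ^ k))"
  have "1 + r / 2 ^ Suc k \<le> exp (r / 2 ^ Suc k)" by (rule exp_ge_add_one_self)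
  also have "\<dots> \<le> exp (real (m + 1) / 2 ^ Suc k)" using r by (simp add: divide_right_mono)
  finally have "(2 ^ Suc k / r) * (1 + r / 2 ^ Suc k) \<le> (2 ^ Suc k / r) * exp (real (m + 1) / 2 ^ Suc k)"
    using r by (intro mult_left_mono) auto
  also have "(2 ^ Suc k / r) * (1 + r / 2 ^ Suc k) = 1 + 2 ^ Suc k / r"
    using r by (simp add: field_simps)
  finally have step: "1 + 2 ^ Suc k / r \<le> (2 ^ Suc k / r) * exp (real (m + 1) / 2 ^ Suc k)" .
  have "amp m (Suc k) = amp m k * (4 * q * (1 + 2 ^ Suc k / r))"
    by (simp add: amp_def r_def)
  also have "\<dots> \<le> ((8 * q) ^ k * 2 ^ (k choose 2) * ?e k * (fact (m + 1 - k) / fact (m + 1)))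
      * (4 * q * ((2 ^ Suc k / r) * exp (real (m + 1) / 2 ^ Suc k)))"
    using Suc q_pos r step by (intro mult_mono mult_left_mono) (auto intro!: mult_nonneg_nonneg)
  also have "\<dots> = (8 * q) ^ Suc k * 2 ^ (Suc k choose 2) * (?e k * exp (real (m + 1) / 2 ^ Suc k))
      * (fact (m + 1 - k) / r / fact (m + 1))"
    by (simp add: numeral_2_eq_2 power_add mult_ac)
  also have "?e k * exp (real (m + 1) / 2 ^ Suc k) = ?e (Suc k)"
    by (simp add: field_simps flip: exp_add)
  also have "fact (m + 1 - k) / r = fact (m + 1 - Suc k)"
  proof -
    have "m + 1 - k = Suc (m - k)" using Suc.prems by simp
    thus ?thesis using r(1) Suc.prems by (simp add: r_def Suc_diff_le del: of_nat_Suc)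
  qed
  finally show ?case .
qed

section \<open>Bounds on the relaxation time\<close>

definition scale :: "nat \<Rightarrow> real" where
  "scale n = fact n / (q ^ n * 2 ^ (n choose 2))"

lemma scale_pos: "0 < scale n"
  using q_pos by (simp add: scale_def)

lemma scale_Suc: "scale (Suc n) = scale n * (real (Suc n) / (q * 2 ^ n))"
  by (simp add: scale_def numeral_2_eq_2 power_add field_simps)

text \<open>Raising the index by one multiplies \<open>scale\<close> by at most
  \<open>1 / q\<close>, because \<open>Suc n \<le> 2 ^ n\<close>. Bounded shifts of scale therefore
  cost only a power of \<open>q\<close>.\<close>

lemma scale_add_le: "q ^ j * scale (m + j) \<le> scale m"
proof (induction j)
  case (Suc j)
  have "Suc n \<le> 2 ^ n" for n by (induction n) auto
  from this[of "m + j"] have "real (Suc (m + j)) \<le> real (2 ^ (m + j))" by (simp only: of_nat_le_iff)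
  hence "real (Suc (m + j)) / 2 ^ (m + j) \<le> 1" by simp
  hence "scale (m + j) * (real (Suc (m + j)) / 2 ^ (m + j)) \<le> scale (m + j) * 1"
    using scale_pos[of "m + j"] by (intro mult_left_mono) auto
  moreover have "q * scale (Suc (m + j)) = scale (m + j) * (real (Suc (m + j)) / 2 ^ (m + j))"
    using q_pos unfolding scale_Suc by simp
  ultimately have "q * scale (Suc (m + j)) \<le> scale (m + j)" by linarith
  hence "q ^ j * (q * scale (Suc (m + j))) \<le> q ^ j * scale (m + j)"
    using q_pos by (intro mult_left_mono) auto
  thus ?case using Suc by (simp add: mult_ac)
qed simp

lemma power_self_le_fact: "real n ^ n \<le> 3 ^ n * fact n"
proof (induction n)
  case (Suc n)
  have "real (Suc n) ^ n \<le> 3 * real n ^ n"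
  proof (cases "n = 0")
    case False
    have "(1 + 1 / real n) ^ n \<le> exp (1 / real n) ^ n"
      by (intro power_mono exp_ge_add_one_self) simp
    also have "\<dots> = exp 1" using False by (simp flip: exp_of_nat_mult)
    also have "\<dots> \<le> 3" by (rule exp_le)
    finally have "(1 + 1 / real n) ^ n * real n ^ n \<le> 3 * real n ^ n"
      by (intro mult_right_mono) auto
    moreover have "(1 + 1 / real n) * real n = real (Suc n)" using False by (simp add: field_simps)
    ultimately show ?thesis by (simp flip: power_mult_distrib)
  qed simp
  hence "real (Suc n) * real (Suc n) ^ n \<le> real (Suc n) * (3 * (3 ^ n * fact n))"
    using Suc by (intro mult_left_mono) auto
  thus ?case by (simp add: mult_ac)
qed simp

lemma T_rel_upper:
  assumes "1 \<le> L" "L \<le> 2 ^ n" "q * 2 ^ n \<le> h"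
  shows "0 < east_gap q L \<and> T_rel q L \<le> scale n * ((36 * (1 + h)) ^ (n + 1) / q)"
proof -
  have h: "0 < h" using assms(3) q_pos by (smt (verit) zero_less_mult_iff zero_less_power)
  have "q * 2 ^ k \<le> h" if "k < n + 1" for k
  proof -
    have "q * 2 ^ k \<le> q * 2 ^ n" using that q_pos by (intro mult_left_mono power_increasing) auto
    thus ?thesis using assms(3) by simp
  qed
  then obtain l where l: "2 ^ (n + 1) * (1 - real (n + 1) / (2 * real (n + 1))) \<le> real l"
    and P: "poincare l ((12 * (1 + h) * real (n + 1) / q) ^ (n + 1) / 2 ^ ((n + 1) choose 2))" (is "poincare l ?K")
    using poincare_iterate[of "n + 1" h "n + 1"] by auto
  \<comment> \<open>One doubling more than \<open>n\<close> compensates for the lost half of the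
    length.\<close>
  have "1 - real (n + 1) / (2 * real (n + 1)) = 1 / 2" by (simp add: field_simps)
  from l[unfolded this] have "real (2 ^ n) \<le> real l" by simp
  hence "L \<le> l" using assms(2) by (simp only: of_nat_le_iff)
  have K: "0 < ?K" using h q_pos by simp
  have gap: "1 / ?K \<le> east_gap q L" by (rule east_gap_ge[OF P K assms(1) \<open>L \<le> l\<close>])
  moreover have "0 < 1 / ?K" by (rule divide_pos_pos[OF zero_less_one K])
  ultimately have pos: "0 < east_gap q L" by linarith
  have "T_rel q L \<le> 1 / (1 / ?K)"
    unfolding T_rel_def using gap pos \<open>0 < 1 / ?K\<close> by (intro divide_left_mono mult_pos_pos) linarith+
  hence "T_rel q L \<le> ?K" by (simp only: divide_divide_eq_right mult_1_left div_by_1)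
  also have "?K = (12 * (1 + h)) ^ (n + 1) * real (n + 1) ^ (n + 1) / (q ^ (n + 1) * 2 ^ ((n + 1) choose 2))"
    by (simp only: power_divide power_mult_distrib divide_divide_eq_left)
  also have "\<dots> \<le> (12 * (1 + h)) ^ (n + 1) * (3 ^ (n + 1) * fact (n + 1)) / (q ^ (n + 1) * 2 ^ ((n + 1) choose 2))"
    using h q_pos by (intro divide_right_mono mult_left_mono power_self_le_fact) auto
  also have "\<dots> = (36 * (1 + h)) ^ (n + 1) * scale (n + 1)"
  proof -
    have "(36 * (1 + h)) ^ (n + 1) = (12 * (1 + h)) ^ (n + 1) * 3 ^ (n + 1)"
      by (subst power_mult_distrib[symmetric]) simp
    thus ?thesis by (simp only: scale_def mult.assoc times_divide_eq_right)
  qed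
  also have "\<dots> \<le> (36 * (1 + h)) ^ (n + 1) * (scale n / q)"
    using scale_add_le[of 1 n] h q_pos by (intro mult_left_mono) (auto simp: field_simps)
  finally show ?thesis using pos by (simp add: mult_ac)
qed

text \<open>\<open>blocked (2 ^ m)\<close> is the test function and \<open>weight m\<close> the
  supersolution. In \<open>48 = 2 * 8 * 3\<close>, the 2 counts the \<open>2 ^ m\<close> sites, the
  8 comes from \<open>amp_le\<close> and the 3 bounds its exponential. For \<open>m = 0\<close> the
  recursion ranges over no lengths.\<close>

lemma T_rel_lower:
  assumes "2 ^ m \<le> L" "m = 0 \<or> q * 2 ^ (m + 4) \<le> 1" "0 < east_gap q L"
  shows "scale m * (q\<^sup>2 / 48 ^ (m + 1)) \<le> T_rel q L"
proof -
  let ?M = "2 ^ m :: nat"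
  have rec: "2 * q * (\<Sum>D'\<in>{D'. D' < D \<and> D \<le> 2 * D'}. weight m D') \<le> weight m D"
    if "2 \<le> D" "D \<le> ?M" for D
    using assms(2) that by (auto intro: weight_recursion)
  have w1: "weight m 1 = 1" using weight_power[of m 0] by (simp add: amp_def)
  have D: "dirichlet q 0 L (blocked ?M) {} \<le> 2 ^ m * amp m m / q"
    using dirichlet_blocked_le[of ?M L "weight m" "{}", OF assms(1) _ weight_nonneg _ rec] w1
    by (simp add: weight_power)
  have "q * 2 ^ m \<le> 1 / 2"
  proof (cases "m = 0")
    case False
    thus ?thesis using assms(2) by (simp add: power_add)
  qed (use q_half in simp)
  hence V: "q / 4 \<le> var q {0<..L} (blocked ?M) {}"
    using var_blocked_ge[of ?M L "{}"] assms(1) by simp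
  have "east_gap q L \<le> dirichlet q 0 L (blocked ?M) {} / var q {0<..L} (blocked ?M) {}"
    using V q_pos by (intro east_gap_le) linarith
  also have "\<dots> \<le> (2 ^ m * amp m m / q) / (q / 4)"
    using D V q_pos amp_nonneg[of m m] dirichlet_nonneg by (intro frac_le) auto
  finally have gap: "east_gap q L \<le> 4 * 2 ^ m * amp m m / q\<^sup>2"
    by (simp add: power2_eq_square mult_ac)
  have "amp m m \<le> (8 * q) ^ m * 2 ^ (m choose 2) * exp (real (m + 1) * (1 - 1 / 2 ^ m)) * (fact 1 / fact (m + 1))"
    using amp_le[of m m] by simp
  also have "\<dots> \<le> (8 * q) ^ m * 2 ^ (m choose 2) * 3 ^ (m + 1) * (fact 1 / fact m)"
  proof -
    have "exp (real (m + 1) * (1 - 1 / 2 ^ m)) \<le> exp (real (m + 1) * 1)"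
      by (intro exp_le_cancel_iff[THEN iffD2] mult_left_mono) auto
    also have "\<dots> = exp 1 ^ (m + 1)" by (rule exp_of_nat_mult)
    also have "\<dots> \<le> 3 ^ (m + 1)" by (intro power_mono exp_le) simp
    finally have "exp (real (m + 1) * (1 - 1 / 2 ^ m)) \<le> (3::real) ^ (m + 1)" .
    moreover have "(fact 1 / fact (m + 1) :: real) \<le> fact 1 / fact m"
      by (intro divide_left_mono fact_mono) auto
    ultimately show ?thesis using q_pos by (intro mult_mono mult_left_mono) auto
  qed
  finally have amp: "amp m m \<le> (8 * q) ^ m * 2 ^ (m choose 2) * 3 ^ (m + 1) / fact m" by simp
  have "4 * 2 ^ m * amp m m / q\<^sup>2 \<le> 4 * 2 ^ m * ((8 * q) ^ m * 2 ^ (m choose 2) * 3 ^ (m + 1) / fact m) / q\<^sup>2"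
    using amp by (intro divide_right_mono mult_left_mono) auto
  also have "\<dots> = 12 * 48 ^ m / (scale m * q\<^sup>2)"
  proof -
    have "(48::real) ^ m = 2 ^ m * 8 ^ m * 3 ^ m" by (simp flip: power_mult_distrib)
    thus ?thesis using q_pos by (simp add: scale_def power_mult_distrib field_simps)
  qed
  also have "\<dots> \<le> 48 ^ (m + 1) / (scale m * q\<^sup>2)"
    using scale_pos[of m] q_pos by (intro divide_right_mono) auto
  finally have "east_gap q L \<le> 48 ^ (m + 1) / (scale m * q\<^sup>2)" using gap by linarith
  hence "1 / (48 ^ (m + 1) / (scale m * q\<^sup>2)) \<le> 1 / east_gap q L"
    using assms(3) by (intro divide_left_mono mult_pos_pos) (auto simp: scale_pos q_pos)
  thus ?thesis by (simp add: T_rel_def)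
qed

end

text \<open>\<open>2 ^ n\<close> is at most a constant times \<open>1 / q\<close>, so any
  exponential in \<open>n\<close> is polynomial in \<open>1 / q\<close>. As
  \<open>1 / q \<ge> 2\<close>, the constant depending on \<open>d\<close> is itself absorbed into
  the power \<open>s\<close>.\<close>

lemma geometric_le_powr:
  fixes G d :: real
  assumes "1 \<le> G" "0 < d"
  shows "\<exists>\<beta>\<ge>0. \<forall>q n. 0 < q \<and> q < 1/2 \<and> q * 2 ^ n \<le> 2 * d \<longrightarrow> G ^ (n + 1) \<le> q powr (- \<beta>)"
proof (intro exI conjI allI impI)
  define g where "g = log 2 G"
  define s where "s = log 2 (4 * d + 1)"
  have g: "0 \<le> g" using assms by (simp add: g_def)
  have s: "0 \<le> s" using assms by (simp add: s_def)
  show "0 \<le> g * (s + 1)" using g s by simp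
  fix q :: real and n :: nat
  assume q: "0 < q \<and> q < 1/2 \<and> q * 2 ^ n \<le> 2 * d"
  have "4 * d + 1 = 2 powr s" using assms by (simp add: s_def)
  also have "\<dots> \<le> (1 / q) powr s" using q s by (intro powr_mono2) (auto simp: field_simps)
  finally have d: "4 * d + 1 \<le> (1 / q) powr s" .
  have "(2::real) ^ (n + 1) \<le> (4 * d + 1) * (1 / q)" using q by (simp add: field_simps)
  also have "\<dots> \<le> (1 / q) powr s * (1 / q) powr 1"
    using d q by (intro mult_mono) auto
  also have "\<dots> = (1 / q) powr (s + 1)" by (rule powr_add[symmetric])
  finally have two: "(2::real) ^ (n + 1) \<le> (1 / q) powr (s + 1)" .
  have "2 powr g = G" using assms by (simp add: g_def)
  hence "G ^ (n + 1) = (2 powr g) powr real (n + 1)"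
    using powr_realpow[of G "n + 1"] assms by (simp only:)
  also have "\<dots> = (2 ^ (n + 1)) powr g"
    by (simp only: powr_powr mult.commute[of g] powr_realpow[symmetric] zero_less_numeral)
  also have "\<dots> \<le> ((1 / q) powr (s + 1)) powr g"
    using two g by (intro powr_mono2) auto
  also have "\<dots> = q powr (- (g * (s + 1)))"
    using q by (simp add: powr_powr powr_divide powr_minus_divide mult.commute)
  finally show "G ^ (n + 1) \<le> q powr (- (g * (s + 1)))" .
qed

theorem mainTheorem2:
  fixes d :: real
  assumes "d > 0"
  shows "\<exists>\<alpha> \<alpha>' :: real. \<alpha> > 0 \<and> \<alpha>' > 0 \<and>
    (\<forall>q::real. \<forall>L::nat. 0 < q \<and> q < 1/2 \<and> 1 \<le> L \<and> real L \<le> d / q \<longrightarrow>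
      (let n = nat \<lceil>log 2 (real L)\<rceil> in
        fact n / (q ^ n * 2 ^ (n choose 2)) * q powr \<alpha> \<le> T_rel q L \<and>
        T_rel q L \<le> fact n / (q ^ n * 2 ^ (n choose 2)) * q powr (- \<alpha>')))"
proof -
  obtain \<beta> where \<beta>: "0 \<le> \<beta>"
    "\<And>q n. 0 < q \<and> q < 1/2 \<and> q * 2 ^ n \<le> 2 * d \<Longrightarrow> 48 ^ (n + 1) \<le> q powr (- \<beta>)"
    using geometric_le_powr[of 48 d] assms by auto
  obtain \<gamma> where \<gamma>: "0 \<le> \<gamma>"
    "\<And>q n. 0 < q \<and> q < 1/2 \<and> q * 2 ^ n \<le> 2 * d \<Longrightarrow> (36 * (1 + 2 * d)) ^ (n + 1) \<le> q powr (- \<gamma>)"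
    using geometric_le_powr[of "36 * (1 + 2 * d)" d] assms by auto
  \<comment> \<open>Lowering the scale by \<open>K0\<close> gives
    \<open>q * 2 ^ (m + 4) \<le> 1\<close>, because \<open>16 * 2 * d \<le> 2 ^ K0\<close>; the
    summand 2 ensures \<open>2 ^ m \<le> L\<close> from \<open>2 ^ n \<le> 2 * L\<close>.\<close>
  obtain K0 :: nat where K0: "32 * d + 2 < 2 ^ K0"
    using real_arch_pow[of 2 "32 * d + 2"] by auto
  \<comment> \<open>In the lower exponent, \<open>\<beta>\<close> pays for
    \<open>48 ^ (m + 1)\<close>, 2 for \<open>q\<^sup>2\<close> and \<open>K0\<close> for passing
    from \<open>scale m\<close> to \<open>scale n\<close>. In the upper one, \<open>\<gamma>\<close>
    pays for the geometric factor and 1 for the extra doubling.\<close>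
  have bound: "fact n / (q ^ n * 2 ^ (n choose 2)) * q powr (\<beta> + 2 + real K0) \<le> T_rel q L \<and>
        T_rel q L \<le> fact n / (q ^ n * 2 ^ (n choose 2)) * q powr (- (\<gamma> + 1))"
    if q: "0 < q" "q < 1/2" and L: "1 \<le> L" "real L \<le> d / q" and n: "n = nat \<lceil>log 2 (real L)\<rceil>" for q L n
  proof -
    interpret bernoulli q by unfold_locales (use q in auto)
    have log0: "0 \<le> log 2 (real L)" using L by simp
    have "real n = of_int \<lceil>log 2 (real L)\<rceil>" using log0 by (simp add: n)
    hence nb: "log 2 (real L) \<le> real n" "real n \<le> log 2 (real L) + 1" by linarith+
    have pL: "2 powr log 2 (real L) = real L" using L by simp
    have "real L \<le> 2 powr real n" using nb(1) by (subst pL[symmetric]) (rule powr_mono, auto)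
    hence "real L \<le> real (2 ^ n)" by (simp add: powr_realpow)
    hence Ln: "L \<le> 2 ^ n" by (simp only: of_nat_le_iff)
    have "2 powr real n \<le> 2 powr (log 2 (real L) + 1)" using nb(2) by (intro powr_mono) auto
    hence nL: "2 ^ n \<le> 2 * real L" by (simp add: powr_add pL powr_realpow)
    have qL: "q * real L \<le> d" using L(2) q by (simp add: field_simps)
    have "q * 2 ^ n \<le> q * (2 * real L)" using nL q by (intro mult_left_mono) auto
    hence qn: "q * 2 ^ n \<le> 2 * d" using qL by simp
    have upper: "0 < east_gap q L" "T_rel q L \<le> scale n * ((36 * (1 + 2 * d)) ^ (n + 1) / q)"
      using T_rel_upper[OF L(1) Ln qn] by auto
    have "(36 * (1 + 2 * d)) ^ (n + 1) / q \<le> q powr (- \<gamma>) / q"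
      using \<gamma>(2)[of q n] q qn by (intro divide_right_mono) auto
    also have "\<dots> = q powr (- \<gamma>) * q powr (- 1)" using q by (simp add: powr_minus_divide)
    also have "\<dots> = q powr (- (\<gamma> + 1))" by (simp only: powr_add[symmetric] minus_add_distrib)
    finally have "scale n * ((36 * (1 + 2 * d)) ^ (n + 1) / q) \<le> scale n * q powr (- (\<gamma> + 1))"
      using scale_pos[of n] by (intro mult_left_mono) auto
    with upper(2) have up: "T_rel q L \<le> scale n * q powr (- (\<gamma> + 1))" by linarith
    \<comment> \<open>Truncated subtraction gives \<open>m = 0\<close> when
      \<open>n \<le> K0\<close>, the case that \<open>T_rel_lower\<close> admits without a smallness
      condition.\<close>
    define m where "m = n - K0"
    have m0: "2 ^ m * 2 ^ K0 = (2::real) ^ n" if "m \<noteq> 0"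
      using that by (simp add: m_def flip: power_add)
    have "real (2 ^ m) \<le> real L"
    proof (cases "m = 0")
      case False
      have "2 ^ m * 2 \<le> 2 ^ m * (2::real) ^ K0" using K0 assms by (intro mult_left_mono) auto
      hence "2 ^ m \<le> real L" using m0[OF False] nL by linarith
      thus ?thesis by (simp only: of_nat_power of_nat_numeral)
    qed (use L in simp)
    hence mL: "2 ^ m \<le> L" by (simp only: of_nat_le_iff)
    have "q * 2 ^ (m + 4) \<le> 1" if "m \<noteq> 0"
    proof -
      have "q * 2 ^ (m + 4) * 2 ^ K0 = 16 * (q * 2 ^ n)"
        using m0[OF that] by (simp add: power_add mult_ac)
      also have "\<dots> \<le> 1 * 2 ^ K0" using qn K0 by simp
      finally show ?thesis by simp
    qed
    hence "m = 0 \<or> q * 2 ^ (m + 4) \<le> 1" by (cases "m = 0") simp_all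
    from T_rel_lower[OF mL this upper(1)]
    have low: "scale m * (q\<^sup>2 / 48 ^ (m + 1)) \<le> T_rel q L" .
    have "q powr \<beta> * 48 ^ (m + 1) \<le> 1"
    proof -
      have "(48::real) ^ (m + 1) \<le> 48 ^ (n + 1)" by (intro power_increasing) (auto simp: m_def)
      also have "\<dots> \<le> q powr (- \<beta>)" using \<beta>(2)[of q n] q qn by simp
      finally have "q powr \<beta> * 48 ^ (m + 1) \<le> q powr \<beta> * q powr (- \<beta>)"
        by (intro mult_left_mono) auto
      thus ?thesis using q by (simp flip: powr_add)
    qed
    hence b: "q powr \<beta> \<le> 1 / 48 ^ (m + 1)" by (simp add: field_simps)
    define j where "j = n - m"
    have j: "n = m + j" "j \<le> K0" by (auto simp: j_def m_def)
    have "q ^ K0 * scale n \<le> q ^ j * scale n"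
      using q j scale_pos[of n] by (intro mult_right_mono power_decreasing) auto
    also have "\<dots> \<le> scale m" using scale_add_le[of j m] j(1) by simp
    finally have a: "q ^ K0 * scale n \<le> scale m" .
    have "scale n * q powr (\<beta> + 2 + real K0) = (q ^ K0 * scale n) * (q\<^sup>2 * q powr \<beta>)"
      using q by (simp add: powr_add powr_realpow mult_ac)
    also have "\<dots> \<le> scale m * (q\<^sup>2 * (1 / 48 ^ (m + 1)))"
      using a b scale_pos q by (intro mult_mono mult_left_mono) (auto intro: less_imp_le)
    also have "\<dots> \<le> T_rel q L" using low by simp
    finally show ?thesis using up by (simp only: scale_def)
  qed
  show ?thesis
    using bound \<beta>(1) \<gamma>(1)
    by (intro exI[of _ "\<beta> + 2 + real K0"] exI[of _ "\<gamma> + 1"]) (auto simp: Let_def)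
qed

end
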